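(* Let $\Lambda=\{1,\dots,n\}$ and let $R=T(V)/\langle x_\alpha\otimes x_\beta-(-1)^{|x_\alpha||x_\beta|}x_\beta\otimes x_\alpha\mid\alpha,\beta\in\Lambda\rangle$ be a DG Poisson algebra with an arbitrary differential $d$ and Poisson structure $\{\cdot,\cdot\}$. Suppose that $A=R/I$ is a DG Poisson homomorphic image of $R$, where $I$ is a DG Poisson ideal of $R$. If $P$ is a DG symplectic ideal of $A$, then $P$ is the annihilator of a simple DG Poisson $A$-module, that is, there is a simple DG Poisson $A$-module $X$ with $P=\{a\in A\mid a\cdot X=0\}$.
   Context: $\Bbbk$ is a field; graded means $\mathbb{Z}$-graded; algebras are associative and unital, modules are unitary; $|a|$ is the degree of a homogeneous element $a$. A DG Poisson algebra $(A,\cdot,\{\cdot,\cdot\},d)$ is a graded algebra with $ab=(-1)^{|a||b|}ba$, a $\Bbbk$-linear map $d$ of degree $1$ with $d^2=0$ and $d(ab)=d(a)b+(-1)^{|a|}a\,d(b)$, and a $\Bbbk$-bilinear bracket of degree $0$ such that, for homogeneous $a,b,c$: $\{a,b\}=-(-1)^{|a||b|}\{b,a\}$; $\{a,\{b,c\}\}=\{\{a,b\},c\}+(-1)^{|a||b|}\{b,\{a,c\}\}$; $\{a,bc\}=\{a,b\}c+(-1)^{|a||b|}b\{a,c\}$; $d(\{a,b\})=\{d(a),b\}+(-1)^{|a|}\{a,d(b)\}$. A DG ideal is a homogeneous ideal $I$ with $d(I)\subseteq I$; it is a DG Poisson ideal if moreover $\{I,A\}\subseteq I$. $V$ is a graded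 vector space with homogeneous basis $x_1,\dots,x_n$ and $T(V)$ is its tensor algebra. $A=R/I$ carries the induced DG Poisson structure. A (left) DG Poisson $A$-module is a left graded $A$-module $M$ with a $\Bbbk$-linear map $\partial:M\to M$ of degree $1$ and a $\Bbbk$-bilinear map $\{\cdot,\cdot\}_M:A\times M\to M$ of degree $0$ such that, for homogeneous $a,b\in A$, $m\in M$: $\partial^2=0$; $\partial(am)=d(a)m+(-1)^{|a|}a\,\partial(m)$; $\{a,bm\}_M=\{a,b\}m+(-1)^{|a||b|}b\{a,m\}_M$; $\{ab,m\}_M=a\{b,m\}_M+(-1)^{|a||b|}b\{a,m\}_M$; $\{a,\{b,m\}_M\}_M=\{\{a,b\},m\}_M+(-1)^{|a||b|}\{b,\{a,m\}_M\}_M$; $\partial(\{a,m\}_M)=\{d(a),m\}_M+(-1)^{|a|}\{a,\partial(m)\}_M$. A DG Poisson submodule is a graded submodule $N$ with $\partial(N)\subseteq N$ and $\{A,N\}_M\subseteq N$. A simple DG Poisson module is a DG Poisson module having no non-zero proper DG Poisson submodule. A DG Poisson ideal $Q$ of a DG Poisson algebra $B$ is a DG symplectic ideal if there is a maximal DG ideal $M$ of $B$ such that $Q$ is the largest DG Poisson ideal contained in $M$. *)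

theory Defs
  imports "HOL.Hull" "HOL-Algebra.QuotRing" "HOL-Algebra.Module"
begin

section \<open>Graded modules and graded algebras\<close>

record ('s, 'a) graded = "('s, 'a) module" +
  comp :: "int \<Rightarrow> 'a set"

text \<open>\<open>f\<close> is the family of homogeneous components of \<open>a\<close>.\<close>

definition homogeneous_decomp ::
    "('s, 'a, 'z) graded_scheme \<Rightarrow> (int \<Rightarrow> 'a) \<Rightarrow> 'a \<Rightarrow> bool" where
  "homogeneous_decomp M f a \<longleftrightarrow>
     (\<forall>i. f i \<in> comp M i) \<and> finite {i. f i \<noteq> \<zero>\<^bsub>M\<^esub>} \<and>
     a = (\<Oplus>\<^bsub>M\<^esub>i\<in>{i. f i \<noteq> \<zero>\<^bsub>M\<^esub>}. f i)"

definition homogeneous_subset :: "('s, 'a, 'z) graded_scheme \<Rightarrow> 'a set \<Rightarrow> bool" where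
  "homogeneous_subset M H \<longleftrightarrow>
     H \<subseteq> carrier M \<and> (\<forall>a\<in>H. \<exists>f. homogeneous_decomp M f a \<and> (\<forall>i. f i \<in> H))"

locale graded_group = abelian_group M for M :: "('s, 'a, 'z) graded_scheme" (structure) +
  assumes comp_subgroup: "additive_subgroup (comp M i) M"
    and direct_sum: "a \<in> carrier M \<Longrightarrow> \<exists>!f. homogeneous_decomp M f a"

locale graded_vector_space = field K + Vec: module K V + Vec: graded_group V
  for K :: "('k, 'c) ring_scheme" (structure)
  and V :: "('k, 'v, 'z) graded_scheme" (structure) +
  assumes smult_comp: "\<lbrakk>c \<in> carrier K; v \<in> comp V i\<rbrakk> \<Longrightarrow> c \<odot>\<^bsub>V\<^esub> v \<in> comp V i"

locale graded_algebra = graded_vector_space K A + Alg: ring A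
  for K :: "('k, 'c) ring_scheme" (structure)
  and A :: "('k, 'a, 'z) graded_scheme" (structure) +
  assumes smult_mult_left:
      "\<lbrakk>c \<in> carrier K; a \<in> carrier A; b \<in> carrier A\<rbrakk>
        \<Longrightarrow> (c \<odot>\<^bsub>A\<^esub> a) \<otimes>\<^bsub>A\<^esub> b = c \<odot>\<^bsub>A\<^esub> (a \<otimes>\<^bsub>A\<^esub> b)"
    and smult_mult_right:
      "\<lbrakk>c \<in> carrier K; a \<in> carrier A; b \<in> carrier A\<rbrakk>
        \<Longrightarrow> a \<otimes>\<^bsub>A\<^esub> (c \<odot>\<^bsub>A\<^esub> b) = c \<odot>\<^bsub>A\<^esub> (a \<otimes>\<^bsub>A\<^esub> b)"
    and one_comp: "\<one>\<^bsub>A\<^esub> \<in> comp A 0"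
    and mult_comp: "\<lbrakk>a \<in> comp A i; b \<in> comp A j\<rbrakk> \<Longrightarrow> a \<otimes>\<^bsub>A\<^esub> b \<in> comp A (i + j)"

text \<open>\<open>koszul M k a\<close> is $(-1)^k a$.\<close>

definition koszul :: "('a, 'z) ring_scheme \<Rightarrow> int \<Rightarrow> 'a \<Rightarrow> 'a" where
  "koszul M k a = (if even k then a else \<ominus>\<^bsub>M\<^esub> a)"


section \<open>DG Poisson algebras\<close>

record ('s, 'a) dg = "('s, 'a) graded" +
  differential :: "'a \<Rightarrow> 'a"

record ('k, 'a) dg_poisson = "('k, 'a) dg" +
  bracket :: "'a \<Rightarrow> 'a \<Rightarrow> 'a"

locale dg_poisson_algebra = graded_algebra K A
  for K :: "('k, 'c) ring_scheme" (structure)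
  and A :: "('k, 'a, 'z) dg_poisson_scheme" (structure) +
  assumes graded_commutative:
      "\<lbrakk>a \<in> comp A i; b \<in> comp A j\<rbrakk>
        \<Longrightarrow> a \<otimes>\<^bsub>A\<^esub> b = koszul A (i * j) (b \<otimes>\<^bsub>A\<^esub> a)"
    and differential_add:
      "\<lbrakk>a \<in> carrier A; b \<in> carrier A\<rbrakk>
        \<Longrightarrow> differential A (a \<oplus>\<^bsub>A\<^esub> b) = differential A a \<oplus>\<^bsub>A\<^esub> differential A b"
    and differential_smult:
      "\<lbrakk>c \<in> carrier K; a \<in> carrier A\<rbrakk>
        \<Longrightarrow> differential A (c \<odot>\<^bsub>A\<^esub> a) = c \<odot>\<^bsub>A\<^esub> differential A a"
    and differential_comp: "a \<in> comp A i \<Longrightarrow> differential A a \<in> comp A (i + 1)"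
    and differential_square:
      "a \<in> carrier A \<Longrightarrow> differential A (differential A a) = \<zero>\<^bsub>A\<^esub>"
    and differential_mult:
      "\<lbrakk>a \<in> comp A i; b \<in> comp A j\<rbrakk>
        \<Longrightarrow> differential A (a \<otimes>\<^bsub>A\<^esub> b)
            = differential A a \<otimes>\<^bsub>A\<^esub> b \<oplus>\<^bsub>A\<^esub> koszul A i (a \<otimes>\<^bsub>A\<^esub> differential A b)"
    and bracket_add_left:
      "\<lbrakk>a \<in> carrier A; a' \<in> carrier A; b \<in> carrier A\<rbrakk>
        \<Longrightarrow> bracket A (a \<oplus>\<^bsub>A\<^esub> a') b = bracket A a b \<oplus>\<^bsub>A\<^esub> bracket A a' b"
    and bracket_add_right:
      "\<lbrakk>a \<in> carrier A; b \<in> carrier A; b' \<in> carrier A\<rbrakk>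
        \<Longrightarrow> bracket A a (b \<oplus>\<^bsub>A\<^esub> b') = bracket A a b \<oplus>\<^bsub>A\<^esub> bracket A a b'"
    and bracket_smult_left:
      "\<lbrakk>c \<in> carrier K; a \<in> carrier A; b \<in> carrier A\<rbrakk>
        \<Longrightarrow> bracket A (c \<odot>\<^bsub>A\<^esub> a) b = c \<odot>\<^bsub>A\<^esub> bracket A a b"
    and bracket_smult_right:
      "\<lbrakk>c \<in> carrier K; a \<in> carrier A; b \<in> carrier A\<rbrakk>
        \<Longrightarrow> bracket A a (c \<odot>\<^bsub>A\<^esub> b) = c \<odot>\<^bsub>A\<^esub> bracket A a b"
    and bracket_comp:
      "\<lbrakk>a \<in> comp A i; b \<in> comp A j\<rbrakk> \<Longrightarrow> bracket A a b \<in> comp A (i + j)"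
    and bracket_antisym:
      "\<lbrakk>a \<in> comp A i; b \<in> comp A j\<rbrakk>
        \<Longrightarrow> bracket A a b = \<ominus>\<^bsub>A\<^esub> koszul A (i * j) (bracket A b a)"
    and bracket_jacobi:
      "\<lbrakk>a \<in> comp A i; b \<in> comp A j; e \<in> comp A l\<rbrakk>
        \<Longrightarrow> bracket A a (bracket A b e)
            = bracket A (bracket A a b) e
              \<oplus>\<^bsub>A\<^esub> koszul A (i * j) (bracket A b (bracket A a e))"
    and bracket_leibniz:
      "\<lbrakk>a \<in> comp A i; b \<in> comp A j; e \<in> comp A l\<rbrakk>
        \<Longrightarrow> bracket A a (b \<otimes>\<^bsub>A\<^esub> e)
            = bracket A a b \<otimes>\<^bsub>A\<^esub> e \<oplus>\<^bsub>A\<^esub> koszul A (i * j) (b \<otimes>\<^bsub>A\<^esub> bracket A a e)"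
    and differential_bracket:
      "\<lbrakk>a \<in> comp A i; b \<in> comp A j\<rbrakk>
        \<Longrightarrow> differential A (bracket A a b)
            = bracket A (differential A a) b
              \<oplus>\<^bsub>A\<^esub> koszul A i (bracket A a (differential A b))"

definition dg_ideal :: "'a set \<Rightarrow> ('k, 'a, 'z) dg_scheme \<Rightarrow> bool" where
  "dg_ideal I A \<longleftrightarrow> ideal I A \<and> homogeneous_subset A I \<and> (\<forall>a\<in>I. differential A a \<in> I)"

definition dg_poisson_ideal :: "'a set \<Rightarrow> ('k, 'a, 'z) dg_poisson_scheme \<Rightarrow> bool" where
  "dg_poisson_ideal I A \<longleftrightarrow>
     dg_ideal I A \<and> (\<forall>a\<in>I. \<forall>b\<in>carrier A. bracket A a b \<in> I)"

definition maximal_dg_ideal :: "'a set \<Rightarrow> ('k, 'a, 'z) dg_scheme \<Rightarrow> bool" where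
  "maximal_dg_ideal M A \<longleftrightarrow>
     dg_ideal M A \<and> M \<noteq> carrier A \<and>
     (\<forall>J. dg_ideal J A \<and> M \<subseteq> J \<longrightarrow> J = M \<or> J = carrier A)"

definition dg_symplectic_ideal :: "'a set \<Rightarrow> ('k, 'a, 'z) dg_poisson_scheme \<Rightarrow> bool" where
  "dg_symplectic_ideal Q A \<longleftrightarrow>
     (\<exists>M. maximal_dg_ideal M A \<and>
          dg_poisson_ideal Q A \<and> Q \<subseteq> M \<and>
          (\<forall>J. dg_poisson_ideal J A \<and> J \<subseteq> M \<longrightarrow> J \<subseteq> Q))"


section \<open>Quotients\<close>

text \<open>
  As in \<^const>\<open>rcoset_mult\<close>, an operation on cosets is the union of the cosets of its
  values on representatives; for an operation compatible with the ideal this union is a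
  single coset.
\<close>

definition quot_algebra ::
    "('k, 'a, 'z) module_scheme \<Rightarrow> 'a set \<Rightarrow> ('k, 'a set) module" where
  "quot_algebra A I =
     ring.extend (A Quot I)
       (module.fields (\<lambda>c X. \<Union>a\<in>X. I +>\<^bsub>A\<^esub> (c \<odot>\<^bsub>A\<^esub> a)))"

definition quot_graded ::
    "('k, 'a, 'z) graded_scheme \<Rightarrow> 'a set \<Rightarrow> ('k, 'a set) graded" where
  "quot_graded A I =
     module.extend (quot_algebra A I)
       (graded.fields (\<lambda>i. (\<lambda>a. I +>\<^bsub>A\<^esub> a) ` comp A i))"

definition add_dg_poisson ::
    "('k, 'a) graded \<Rightarrow> ('a \<Rightarrow> 'a) \<Rightarrow> ('a \<Rightarrow> 'a \<Rightarrow> 'a) \<Rightarrow> ('k, 'a) dg_poisson" where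
  "add_dg_poisson A d br =
     dg.extend (graded.extend A (dg.fields d)) (dg_poisson.fields br)"

definition quot_dg_poisson ::
    "('k, 'a, 'z) dg_poisson_scheme \<Rightarrow> 'a set \<Rightarrow> ('k, 'a set) dg_poisson" where
  "quot_dg_poisson A I =
     add_dg_poisson (quot_graded A I)
       (\<lambda>X. \<Union>a\<in>X. I +>\<^bsub>A\<^esub> differential A a)
       (\<lambda>X Y. \<Union>a\<in>X. \<Union>b\<in>Y. I +>\<^bsub>A\<^esub> bracket A a b)"


section \<open>The tensor algebra and its graded symmetric quotient\<close>

text \<open>
  The free algebra on a set \<open>S\<close>: finitely supported \<open>K\<close>-valued functions on words over \<open>S\<close>,
  multiplied by convolution with respect to concatenation.
\<close>

definition free_algebra ::
    "('k, 'z) ring_scheme \<Rightarrow> 's set \<Rightarrow> ('k, 's list \<Rightarrow> 'k) module" where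
  "free_algebra K S =
     \<lparr>carrier = {f. (\<forall>w. f w \<in> carrier K) \<and> finite {w. f w \<noteq> \<zero>\<^bsub>K\<^esub>} \<and>
                    (\<forall>w. w \<notin> lists S \<longrightarrow> f w = \<zero>\<^bsub>K\<^esub>)},
      mult = (\<lambda>f g w. \<Oplus>\<^bsub>K\<^esub>i\<in>{..length w}. f (take i w) \<otimes>\<^bsub>K\<^esub> g (drop i w)),
      one = (\<lambda>w. if w = [] then \<one>\<^bsub>K\<^esub> else \<zero>\<^bsub>K\<^esub>),
      zero = (\<lambda>w. \<zero>\<^bsub>K\<^esub>),
      add = (\<lambda>f g w. f w \<oplus>\<^bsub>K\<^esub> g w),
      smult = (\<lambda>c f w. c \<otimes>\<^bsub>K\<^esub> f w)\<rparr>"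

definition word :: "('k, 'z) ring_scheme \<Rightarrow> 's list \<Rightarrow> 's list \<Rightarrow> 'k" where
  "word K u = (\<lambda>w. if w = u then \<one>\<^bsub>K\<^esub> else \<zero>\<^bsub>K\<^esub>)"

text \<open>
  The tensor algebra of \<open>V\<close> is presented basis-free: it is the free algebra on the set of
  all vectors of \<open>V\<close>, modulo the ideal that makes \<open>v \<mapsto> [v]\<close> linear.  The class of
  the word \<open>[v\<^sub>1, \<dots>, v\<^sub>r]\<close> is $v_1 \otimes \dots \otimes v_r$, and the component of
  degree \<open>i\<close> is spanned by the $v_1 \otimes \dots \otimes v_r$ with homogeneous factors
  whose degrees add up to \<open>i\<close>.
\<close>

definition linearity_ideal ::
    "('k, 'z) ring_scheme \<Rightarrow> ('k, 'v, 'y) graded_scheme \<Rightarrow> ('v list \<Rightarrow> 'k) set" where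
  "linearity_ideal K V =
     (let F = free_algebra K (carrier V) in
      Idl\<^bsub>F\<^esub> ({word K [v \<oplus>\<^bsub>V\<^esub> w] \<ominus>\<^bsub>F\<^esub> (word K [v] \<oplus>\<^bsub>F\<^esub> word K [w]) |
                 v w. v \<in> carrier V \<and> w \<in> carrier V} \<union>
              {word K [c \<odot>\<^bsub>V\<^esub> v] \<ominus>\<^bsub>F\<^esub> (c \<odot>\<^bsub>F\<^esub> word K [v]) |
                 c v. c \<in> carrier K \<and> v \<in> carrier V}))"

definition tensor ::
    "('k, 'z) ring_scheme \<Rightarrow> ('k, 'v, 'y) graded_scheme \<Rightarrow> 'v list \<Rightarrow> ('v list \<Rightarrow> 'k) set" where
  "tensor K V vs =
     linearity_ideal K V +>\<^bsub>free_algebra K (carrier V)\<^esub> word K vs"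

definition tensor_algebra ::
    "('k, 'z) ring_scheme \<Rightarrow> ('k, 'v, 'y) graded_scheme
      \<Rightarrow> ('k, ('v list \<Rightarrow> 'k) set) graded" where
  "tensor_algebra K V =
     (let T = quot_algebra (free_algebra K (carrier V)) (linearity_ideal K V) in
      module.extend T
        (graded.fields
          (\<lambda>i. (\<lambda>H. submodule H K T) hull
                 {tensor K V vs | vs es.
                    list_all2 (\<lambda>v e. v \<in> comp V e) vs es \<and> sum_list es = i})))"

definition homogeneous_basis ::
    "('k, 'z) ring_scheme \<Rightarrow> ('k, 'v, 'y) graded_scheme
      \<Rightarrow> nat \<Rightarrow> (nat \<Rightarrow> 'v) \<Rightarrow> (nat \<Rightarrow> int) \<Rightarrow> bool" where
  "homogeneous_basis K V n x deg \<longleftrightarrow>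
     (\<forall>\<alpha>\<in>{1..n}. x \<alpha> \<in> comp V (deg \<alpha>)) \<and>
     (\<forall>v\<in>carrier V. \<exists>!c. c \<in> {1..n} \<rightarrow>\<^sub>E carrier K \<and>
        v = (\<Oplus>\<^bsub>V\<^esub>\<alpha>\<in>{1..n}. c \<alpha> \<odot>\<^bsub>V\<^esub> x \<alpha>))"

definition graded_symmetric_algebra ::
    "('k, 'z) ring_scheme \<Rightarrow> ('k, 'v, 'y) graded_scheme
      \<Rightarrow> nat \<Rightarrow> (nat \<Rightarrow> 'v) \<Rightarrow> (nat \<Rightarrow> int)
      \<Rightarrow> ('k, ('v list \<Rightarrow> 'k) set set) graded" where
  "graded_symmetric_algebra K V n x deg =
     (let T = tensor_algebra K V in
      quot_graded T
        (Idl\<^bsub>T\<^esub> {tensor K V [x \<alpha>, x \<beta>] \<ominus>\<^bsub>T\<^esub>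
                   koszul T (deg \<alpha> * deg \<beta>) (tensor K V [x \<beta>, x \<alpha>]) |
                 \<alpha> \<beta>. \<alpha> \<in> {1..n} \<and> \<beta> \<in> {1..n}}))"


section \<open>DG Poisson modules\<close>

record ('a, 'm) dg_poisson_mod = "('a, 'm) dg" +
  mbracket :: "'a \<Rightarrow> 'm \<Rightarrow> 'm"

text \<open>
  The scalars of an \<open>A\<close>-module record are the elements of \<open>A\<close>; the base field acts through
  the structure map from \<open>K\<close> to \<open>A\<close>.
\<close>

definition base_smult ::
    "('k, 'a, 'z) module_scheme \<Rightarrow> ('a, 'm, 'y) module_scheme \<Rightarrow> 'k \<Rightarrow> 'm \<Rightarrow> 'm" where
  "base_smult A M c m = (c \<odot>\<^bsub>A\<^esub> \<one>\<^bsub>A\<^esub>) \<odot>\<^bsub>M\<^esub> m"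

text \<open>The locale \<^locale>\<open>module\<close> is for commutative rings, hence the explicit module axioms.\<close>

locale graded_left_module = graded_algebra K A + Mod: graded_group M
  for K :: "('k, 'c) ring_scheme" (structure)
  and A :: "('k, 'a, 'z) graded_scheme" (structure)
  and M :: "('a, 'm, 'y) graded_scheme" (structure) +
  assumes act_closed:
      "\<lbrakk>a \<in> carrier A; m \<in> carrier M\<rbrakk> \<Longrightarrow> a \<odot>\<^bsub>M\<^esub> m \<in> carrier M"
    and act_add_left:
      "\<lbrakk>a \<in> carrier A; b \<in> carrier A; m \<in> carrier M\<rbrakk>
        \<Longrightarrow> (a \<oplus>\<^bsub>A\<^esub> b) \<odot>\<^bsub>M\<^esub> m = a \<odot>\<^bsub>M\<^esub> m \<oplus>\<^bsub>M\<^esub> b \<odot>\<^bsub>M\<^esub> m"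
    and act_add_right:
      "\<lbrakk>a \<in> carrier A; m \<in> carrier M; m' \<in> carrier M\<rbrakk>
        \<Longrightarrow> a \<odot>\<^bsub>M\<^esub> (m \<oplus>\<^bsub>M\<^esub> m') = a \<odot>\<^bsub>M\<^esub> m \<oplus>\<^bsub>M\<^esub> a \<odot>\<^bsub>M\<^esub> m'"
    and act_mult:
      "\<lbrakk>a \<in> carrier A; b \<in> carrier A; m \<in> carrier M\<rbrakk>
        \<Longrightarrow> (a \<otimes>\<^bsub>A\<^esub> b) \<odot>\<^bsub>M\<^esub> m = a \<odot>\<^bsub>M\<^esub> (b \<odot>\<^bsub>M\<^esub> m)"
    and act_one: "m \<in> carrier M \<Longrightarrow> \<one>\<^bsub>A\<^esub> \<odot>\<^bsub>M\<^esub> m = m"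
    and act_comp:
      "\<lbrakk>a \<in> comp A i; m \<in> comp M j\<rbrakk> \<Longrightarrow> a \<odot>\<^bsub>M\<^esub> m \<in> comp M (i + j)"

locale dg_poisson_module = dg_poisson_algebra K A + graded_left_module K A M
  for K :: "('k, 'c) ring_scheme" (structure)
  and A :: "('k, 'a, 'z) dg_poisson_scheme" (structure)
  and M :: "('a, 'm, 'y) dg_poisson_mod_scheme" (structure) +
  assumes mdiff_add:
      "\<lbrakk>m \<in> carrier M; m' \<in> carrier M\<rbrakk>
        \<Longrightarrow> differential M (m \<oplus>\<^bsub>M\<^esub> m') = differential M m \<oplus>\<^bsub>M\<^esub> differential M m'"
    and mdiff_smult:
      "\<lbrakk>c \<in> carrier K; m \<in> carrier M\<rbrakk>
        \<Longrightarrow> differential M (base_smult A M c m) = base_smult A M c (differential M m)"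
    and mdiff_comp: "m \<in> comp M i \<Longrightarrow> differential M m \<in> comp M (i + 1)"
    and mdiff_square:
      "m \<in> carrier M \<Longrightarrow> differential M (differential M m) = \<zero>\<^bsub>M\<^esub>"
    and mdiff_act:
      "\<lbrakk>a \<in> comp A i; m \<in> comp M j\<rbrakk>
        \<Longrightarrow> differential M (a \<odot>\<^bsub>M\<^esub> m)
            = differential A a \<odot>\<^bsub>M\<^esub> m \<oplus>\<^bsub>M\<^esub> koszul M i (a \<odot>\<^bsub>M\<^esub> differential M m)"
    and mbracket_add_left:
      "\<lbrakk>a \<in> carrier A; b \<in> carrier A; m \<in> carrier M\<rbrakk>
        \<Longrightarrow> mbracket M (a \<oplus>\<^bsub>A\<^esub> b) m = mbracket M a m \<oplus>\<^bsub>M\<^esub> mbracket M b m"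
    and mbracket_add_right:
      "\<lbrakk>a \<in> carrier A; m \<in> carrier M; m' \<in> carrier M\<rbrakk>
        \<Longrightarrow> mbracket M a (m \<oplus>\<^bsub>M\<^esub> m') = mbracket M a m \<oplus>\<^bsub>M\<^esub> mbracket M a m'"
    and mbracket_smult_left:
      "\<lbrakk>c \<in> carrier K; a \<in> carrier A; m \<in> carrier M\<rbrakk>
        \<Longrightarrow> mbracket M (c \<odot>\<^bsub>A\<^esub> a) m = base_smult A M c (mbracket M a m)"
    and mbracket_smult_right:
      "\<lbrakk>c \<in> carrier K; a \<in> carrier A; m \<in> carrier M\<rbrakk>
        \<Longrightarrow> mbracket M a (base_smult A M c m) = base_smult A M c (mbracket M a m)"
    and mbracket_comp:
      "\<lbrakk>a \<in> comp A i; m \<in> comp M j\<rbrakk> \<Longrightarrow> mbracket M a m \<in> comp M (i + j)"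
    and mbracket_act:
      "\<lbrakk>a \<in> comp A i; b \<in> comp A j; m \<in> comp M l\<rbrakk>
        \<Longrightarrow> mbracket M a (b \<odot>\<^bsub>M\<^esub> m)
            = bracket A a b \<odot>\<^bsub>M\<^esub> m \<oplus>\<^bsub>M\<^esub> koszul M (i * j) (b \<odot>\<^bsub>M\<^esub> mbracket M a m)"
    and mbracket_mult:
      "\<lbrakk>a \<in> comp A i; b \<in> comp A j; m \<in> comp M l\<rbrakk>
        \<Longrightarrow> mbracket M (a \<otimes>\<^bsub>A\<^esub> b) m
            = a \<odot>\<^bsub>M\<^esub> mbracket M b m \<oplus>\<^bsub>M\<^esub> koszul M (i * j) (b \<odot>\<^bsub>M\<^esub> mbracket M a m)"
    and mbracket_jacobi:
      "\<lbrakk>a \<in> comp A i; b \<in> comp A j; m \<in> comp M l\<rbrakk>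
        \<Longrightarrow> mbracket M a (mbracket M b m)
            = mbracket M (bracket A a b) m
              \<oplus>\<^bsub>M\<^esub> koszul M (i * j) (mbracket M b (mbracket M a m))"
    and mdiff_mbracket:
      "\<lbrakk>a \<in> comp A i; m \<in> comp M j\<rbrakk>
        \<Longrightarrow> differential M (mbracket M a m)
            = mbracket M (differential A a) m
              \<oplus>\<^bsub>M\<^esub> koszul M i (mbracket M a (differential M m))"

definition dg_poisson_submodule ::
    "'m set \<Rightarrow> ('k, 'a, 'z) dg_poisson_scheme \<Rightarrow> ('a, 'm, 'y) dg_poisson_mod_scheme \<Rightarrow> bool" where
  "dg_poisson_submodule N A M \<longleftrightarrow>
     submodule N A M \<and> homogeneous_subset M N \<and>
     (\<forall>m\<in>N. differential M m \<in> N) \<and>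
     (\<forall>a\<in>carrier A. \<forall>m\<in>N. mbracket M a m \<in> N)"

text \<open>
  The zero module is not excluded.  It cannot occur as the module attached to a DG symplectic
  ideal: its annihilator is the whole algebra, which is contained in no maximal DG ideal.
\<close>

definition simple_dg_poisson_module ::
    "('k, 'c) ring_scheme \<Rightarrow> ('k, 'a, 'z) dg_poisson_scheme
      \<Rightarrow> ('a, 'm, 'y) dg_poisson_mod_scheme \<Rightarrow> bool" where
  "simple_dg_poisson_module K A M \<longleftrightarrow>
     dg_poisson_module K A M \<and>
     (\<forall>N. dg_poisson_submodule N A M \<longrightarrow> N = {\<zero>\<^bsub>M\<^esub>} \<or> N = carrier M)"

definition module_annihilator ::
    "('a, 'z) ring_scheme \<Rightarrow> ('a, 'm, 'y) module_scheme \<Rightarrow> 'a set" where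
  "module_annihilator A M = {a \<in> carrier A. \<forall>m\<in>carrier M. a \<odot>\<^bsub>M\<^esub> m = \<zero>\<^bsub>M\<^esub>}"

text \<open>
  A quantifier over modules has to fix the type of their elements.  Elements of the module
  are taken to be sets of \<open>K\<close>-valued functions on (the type of) the algebra, the type of
  subquotients of the space of functions from the algebra to \<open>K\<close>.
  Since modules occur only existentially, fixing the type makes the claim no weaker.
\<close>

type_synonym ('k, 'a) concrete_dg_poisson_mod = "('a, ('a \<Rightarrow> 'k) set) dg_poisson_mod"

end

theory Submission
  imports Defs
begin

text \<open>
  Functionals on \<open>A\<close> form a DG Poisson module through the right multiplications, right brackets
  and the right differential of \<open>A\<close>.  Let \<open>I\<close> be a maximal DG ideal whose largest DG Poisson
  ideal is \<open>P\<close>.  Since \<open>I\<close> is homogeneous and \<open>1\<close> has degree \<open>0\<close>, some functional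
  \<open>\<phi>\<close> of degree \<open>0\<close> vanishes on \<open>I\<close> and has \<open>\<phi> 1 = 1\<close>.  Let \<open>X\<close> be a simple quotient
  (Zorn) of the module generated by \<open>\<phi>\<close> inside the graded dual of \<open>A/P\<close>, so that \<open>P\<close>
  annihilates \<open>X\<close>.  Conversely the annihilator \<open>J\<close> of \<open>X\<close> is a DG Poisson ideal.  If
  \<open>J\<close> were not contained in \<open>I\<close>, then \<open>J + I = A\<close> would kill the class of \<open>\<phi>\<close>, since \<open>I\<close>
  kills \<open>\<phi>\<close>; so \<open>J\<close> lies in \<open>I\<close>, hence in \<open>P\<close>.
\<close>

section \<open>Homogeneous components\<close>

text \<open>A maximal DG ideal \<open>I\<close> is in general not stable under brackets, so
  \<open>A\<close> modulo \<open>I\<close> inherits no bracket action and cannot itself be the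
  module; only \<open>P\<close> has that stability. Functionals mediate between the two:
  \<open>\<phi>\<close> vanishes on all of \<open>I\<close>, whereas the functionals obtained from
  it by brackets are only known to vanish on \<open>P\<close>. Since (a \<phi>)(b) = \<phi>(b a),
  multiplication by an element of \<open>I\<close> kills \<open>\<phi>\<close>, and multiplication
  by an element of \<open>P\<close> kills every functional that vanishes on \<open>P\<close>.
  Dualizing turns operations from the right into operations from the left, which removes all signs
  except the one built into the right differential. Because \<open>\<phi>\<close> generates, a
  submodule is proper exactly when it misses \<open>\<phi>\<close>, so Zorn's lemma yields a simple
  quotient without any finiteness condition on \<open>A\<close>. Two points shape the details. The
  axioms speak of homogeneous elements, while functionals are evaluated at arbitrary ones, so most
  identities pass through induction over homogeneous components. And a functional must be nonzero in
  only finitely many degrees, or it would not be a finite sum of homogeneous ones.\<close>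

definition component :: "('s, 'a, 'z) graded_scheme \<Rightarrow> int \<Rightarrow> 'a \<Rightarrow> 'a" where
  "component M i a = (THE f. homogeneous_decomp M f a) i"

lemma (in abelian_group) finsum_induct:
  assumes "finite S" "\<And>i. i \<in> S \<Longrightarrow> f i \<in> carrier G" "\<And>i. i \<in> S \<Longrightarrow> Q (f i)" "Q \<zero>"
    and "\<And>a b. \<lbrakk>a \<in> carrier G; b \<in> carrier G; Q a; Q b\<rbrakk> \<Longrightarrow> Q (a \<oplus> b)"
  shows "Q (\<Oplus>i\<in>S. f i)"
  using assms(1-3)
proof (induction S rule: finite_induct)
  case empty
  then show ?case using assms(4) by simp
next
  case (insert x S)
  then have "f \<in> S \<rightarrow> carrier G" by auto
  with insert show ?case
    by (simp add: assms(5))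
qed

context graded_group
begin

lemma comp_carrier: "a \<in> comp M i \<Longrightarrow> a \<in> carrier M"
  by (rule additive_subgroup.a_Hcarr[OF comp_subgroup])

lemma comp_zero: "\<zero> \<in> comp M i"
  by (rule additive_subgroup.zero_closed[OF comp_subgroup])

lemma comp_add: "\<lbrakk>a \<in> comp M i; b \<in> comp M i\<rbrakk> \<Longrightarrow> a \<oplus> b \<in> comp M i"
  by (rule additive_subgroup.a_closed[OF comp_subgroup])

lemma comp_minus: "a \<in> comp M i \<Longrightarrow> \<ominus> a \<in> comp M i"
  by (rule additive_subgroup.a_inv_closed[OF comp_subgroup])

lemma homogeneous_decompI:
  assumes "finite S" "\<And>i. f i \<in> comp M i" "\<And>i. i \<notin> S \<Longrightarrow> f i = \<zero>" "a = (\<Oplus>i\<in>S. f i)"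
  shows "homogeneous_decomp M f a"
proof -
  have sub: "{i. f i \<noteq> \<zero>} \<subseteq> S" using assms(3) by auto
  have car: "f i \<in> carrier M" for i using comp_carrier[OF assms(2)] .
  have "(\<Oplus>i\<in>{i. f i \<noteq> \<zero>}. f i) = (\<Oplus>i\<in>S. f i)"
    by (rule add.finprod_mono_neutral_cong_left) (use sub assms(1) car in auto)
  then show ?thesis
    unfolding homogeneous_decomp_def using assms sub by (auto dest: finite_subset)
qed

lemma homogeneous_decomp_carrier: "homogeneous_decomp M f a \<Longrightarrow> a \<in> carrier M"
  unfolding homogeneous_decomp_def by (auto intro!: finsum_closed intro: comp_carrier)

lemma component_decomp: "a \<in> carrier M \<Longrightarrow> homogeneous_decomp M (\<lambda>i. component M i a) a"
  unfolding component_def using theI'[OF direct_sum] by simp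

lemma component_unique: "homogeneous_decomp M f a \<Longrightarrow> component M i a = f i"
  unfolding component_def
  using the1_equality[OF direct_sum[OF homogeneous_decomp_carrier]] by simp

lemma component_comp: "a \<in> carrier M \<Longrightarrow> component M i a \<in> comp M i"
  using component_decomp unfolding homogeneous_decomp_def by blast

lemma component_closed: "a \<in> carrier M \<Longrightarrow> component M i a \<in> carrier M"
  using component_comp comp_carrier by blast

lemma finite_component: "a \<in> carrier M \<Longrightarrow> finite {i. component M i a \<noteq> \<zero>}"
  using component_decomp unfolding homogeneous_decomp_def by blast

lemma finsum_component:
  assumes "a \<in> carrier M" "finite S" "{i. component M i a \<noteq> \<zero>} \<subseteq> S"
  shows "(\<Oplus>i\<in>S. component M i a) = a"
proof -
  have "(\<Oplus>i\<in>{i. component M i a \<noteq> \<zero>}. component M i a) = (\<Oplus>i\<in>S. component M i a)"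
    by (rule add.finprod_mono_neutral_cong_left) (use assms component_closed in auto)
  with component_decomp[OF assms(1)] show ?thesis
    unfolding homogeneous_decomp_def by metis
qed

lemma component_homogeneous:
  assumes "a \<in> comp M j"
  shows "component M i a = (if i = j then a else \<zero>)"
  by (rule component_unique, rule homogeneous_decompI[of "{j}"])
    (use assms comp_carrier comp_zero in auto)

lemma component_add:
  assumes "a \<in> carrier M" "b \<in> carrier M"
  shows "component M i (a \<oplus> b) = component M i a \<oplus> component M i b"
proof (rule component_unique)
  let ?S = "{i. component M i a \<noteq> \<zero>} \<union> {i. component M i b \<noteq> \<zero>}"
  have fin: "finite ?S" using assms finite_component by blast
  show "homogeneous_decomp M (\<lambda>i. component M i a \<oplus> component M i b) (a \<oplus> b)"
    by (rule homogeneous_decompI[OF fin])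
      (use assms fin finsum_component[OF _ fin] component_comp comp_add component_closed
        in \<open>auto simp: finsum_addf\<close>)
qed

lemma component_zero: "component M i \<zero> = \<zero>"
  using component_homogeneous[OF comp_zero[of i]] by simp

text \<open>The rule for homogeneous ideals: since the components of \<open>a\<close> again lie in
  \<open>H\<close>, a claim about members of the ideal reduces to its homogeneous members, where the
  axioms apply.\<close>

lemma graded_induct_subset:
  assumes "a \<in> carrier M" "\<And>i. component M i a \<in> H"
    and "\<And>i b. \<lbrakk>b \<in> comp M i; b \<in> H\<rbrakk> \<Longrightarrow> Q b"
    and "\<And>b c. \<lbrakk>b \<in> carrier M; c \<in> carrier M; Q b; Q c\<rbrakk> \<Longrightarrow> Q (b \<oplus> c)"
  shows "Q a"
proof -
  let ?S = "{i. component M i a \<noteq> \<zero>}"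
  have *: "Q (component M i a)" for i
    by (rule assms(3)[OF component_comp[OF assms(1)] assms(2)])
  \<comment> \<open>No case for zero is assumed. Only finitely many of the infinitely many degrees
    are occupied, so zero is itself a component of \<open>a\<close> and falls under the homogeneous
    case.\<close>
  have "Q \<zero>"
  proof (cases "?S = UNIV")
    case True
    then show ?thesis using finite_component[OF assms(1)] by (metis infinite_UNIV_int)
  next
    case False
    then obtain i where "component M i a = \<zero>" by auto
    then show ?thesis using *[of i] by simp
  qed
  then have "Q (\<Oplus>i\<in>?S. component M i a)"
    by (rule finsum_induct[OF finite_component[OF assms(1)] component_closed[OF assms(1)] * _ assms(4)])
  then show ?thesis
    using finsum_component[OF assms(1) finite_component] assms(1) by simp
qed

lemma graded_induct [consumes 1, case_names homogeneous add]:
  assumes "a \<in> carrier M"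
    and "\<And>i b. b \<in> comp M i \<Longrightarrow> Q b"
    and "\<And>b c. \<lbrakk>b \<in> carrier M; c \<in> carrier M; Q b; Q c\<rbrakk> \<Longrightarrow> Q (b \<oplus> c)"
  shows "Q a"
  by (rule graded_induct_subset[of a UNIV]) (use assms in auto)

lemma homogeneous_subset_iff:
  "homogeneous_subset M H \<longleftrightarrow> H \<subseteq> carrier M \<and> (\<forall>a\<in>H. \<forall>i. component M i a \<in> H)"
proof
  assume "homogeneous_subset M H"
  then show "H \<subseteq> carrier M \<and> (\<forall>a\<in>H. \<forall>i. component M i a \<in> H)"
    unfolding homogeneous_subset_def using component_unique by metis
next
  assume "H \<subseteq> carrier M \<and> (\<forall>a\<in>H. \<forall>i. component M i a \<in> H)"
  then show "homogeneous_subset M H"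
    unfolding homogeneous_subset_def using component_decomp by (meson subsetD)
qed

lemma koszul_closed: "a \<in> carrier M \<Longrightarrow> koszul M k a \<in> carrier M"
  by (simp add: koszul_def)

lemma koszul_zero: "koszul M k \<zero> = \<zero>"
  by (simp add: koszul_def)

lemma koszul_comp: "a \<in> comp M i \<Longrightarrow> koszul M k a \<in> comp M i"
  by (simp add: koszul_def comp_minus)

lemma koszul_add:
  "\<lbrakk>a \<in> carrier M; b \<in> carrier M\<rbrakk> \<Longrightarrow> koszul M k (a \<oplus> b) = koszul M k a \<oplus> koszul M k b"
  by (simp add: koszul_def minus_add a_comm)

end

text \<open>\<open>T\<close> is a bare function on carriers, so that the rule applies to partial
  applications of products, brackets and actions as well as to functionals.\<close>

lemma additive_zero:
  assumes "abelian_group G" "abelian_group H"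
    and "\<And>a. a \<in> carrier G \<Longrightarrow> T a \<in> carrier H"
    and "\<And>a b. \<lbrakk>a \<in> carrier G; b \<in> carrier G\<rbrakk> \<Longrightarrow> T (a \<oplus>\<^bsub>G\<^esub> b) = T a \<oplus>\<^bsub>H\<^esub> T b"
  shows "T \<zero>\<^bsub>G\<^esub> = \<zero>\<^bsub>H\<^esub>"
proof -
  interpret G: abelian_group G by fact
  interpret H: abelian_group H by fact
  have "T \<zero>\<^bsub>G\<^esub> \<oplus>\<^bsub>H\<^esub> T \<zero>\<^bsub>G\<^esub> = T \<zero>\<^bsub>G\<^esub>" using assms(4)[of "\<zero>\<^bsub>G\<^esub>" "\<zero>\<^bsub>G\<^esub>"] by simp
  then show ?thesis using assms(3)[OF G.zero_closed] by simp
qed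

lemma additive_minus:
  assumes "abelian_group G" "abelian_group H"
    and "\<And>a. a \<in> carrier G \<Longrightarrow> T a \<in> carrier H"
    and "\<And>a b. \<lbrakk>a \<in> carrier G; b \<in> carrier G\<rbrakk> \<Longrightarrow> T (a \<oplus>\<^bsub>G\<^esub> b) = T a \<oplus>\<^bsub>H\<^esub> T b"
    and "a \<in> carrier G"
  shows "T (\<ominus>\<^bsub>G\<^esub> a) = \<ominus>\<^bsub>H\<^esub> T a"
proof -
  interpret G: abelian_group G by fact
  interpret H: abelian_group H by fact
  have "T (\<ominus>\<^bsub>G\<^esub> a) \<oplus>\<^bsub>H\<^esub> T a = \<zero>\<^bsub>H\<^esub>"
    using assms(4)[of "\<ominus>\<^bsub>G\<^esub> a" a] additive_zero[OF assms(1-4)] assms(5) by (simp add: G.l_neg)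
  then show ?thesis using assms(3,5) by (simp add: H.minus_equality)
qed

lemma additive_koszul:
  assumes "abelian_group G" "abelian_group H"
    and "\<And>a. a \<in> carrier G \<Longrightarrow> T a \<in> carrier H"
    and "\<And>a b. \<lbrakk>a \<in> carrier G; b \<in> carrier G\<rbrakk> \<Longrightarrow> T (a \<oplus>\<^bsub>G\<^esub> b) = T a \<oplus>\<^bsub>H\<^esub> T b"
    and "a \<in> carrier G"
  shows "T (koszul G k a) = koszul H k (T a)"
  using additive_minus[OF assms] by (simp add: koszul_def)

text \<open>A map of degree \<open>k\<close> sends the homogeneous decomposition of \<open>a\<close>
  to one of \<open>T a\<close> with all indices shifted by \<open>k\<close>.\<close>

lemma component_additive:
  assumes "graded_group M" "graded_group Q"
    and "\<And>a. a \<in> carrier M \<Longrightarrow> T a \<in> carrier Q"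
    and "\<And>a b. \<lbrakk>a \<in> carrier M; b \<in> carrier M\<rbrakk> \<Longrightarrow> T (a \<oplus>\<^bsub>M\<^esub> b) = T a \<oplus>\<^bsub>Q\<^esub> T b"
    and "\<And>i a. a \<in> comp M i \<Longrightarrow> T a \<in> comp Q (i + k)"
    and "a \<in> carrier M"
  shows "component Q (i + k) (T a) = T (component M i a)"
proof -
  interpret M: graded_group M by fact
  interpret Q: graded_group Q by fact
  note zero = additive_zero[OF M.abelian_group_axioms Q.abelian_group_axioms assms(3,4)]
  show ?thesis
    using assms(6)
  proof (induction rule: M.graded_induct)
    case (homogeneous j b)
    then show ?case
      using zero by (simp add: M.component_homogeneous Q.component_homogeneous[OF assms(5)])
  next
    case (add b c)
    then show ?case
      by (simp add: assms(3,4) Q.component_add M.component_add M.component_closed)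
  qed
qed

text \<open>Quotients and duals come with explicit candidates for the projections onto the
  components. This turns such candidates into a grading and identifies the abstract
  \<open>component\<close> with them.\<close>

lemma graded_groupI:
  fixes M :: "('s, 'a, 'z) graded_scheme"
  assumes "abelian_group M"
    and "\<And>i. additive_subgroup (comp M i) M"
    and "\<And>i a. a \<in> carrier M \<Longrightarrow> p i a \<in> comp M i"
    and "\<And>i a b. \<lbrakk>a \<in> carrier M; b \<in> carrier M\<rbrakk> \<Longrightarrow> p i (a \<oplus>\<^bsub>M\<^esub> b) = p i a \<oplus>\<^bsub>M\<^esub> p i b"
    and "\<And>i j a. a \<in> comp M j \<Longrightarrow> p i a = (if i = j then a else \<zero>\<^bsub>M\<^esub>)"
    and "\<And>a. a \<in> carrier M \<Longrightarrow> \<exists>S. finite S \<and> (\<forall>i. i \<notin> S \<longrightarrow> p i a = \<zero>\<^bsub>M\<^esub>) \<and>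
               a = (\<Oplus>\<^bsub>M\<^esub>i\<in>S. p i a)"
  shows "graded_group M" "\<And>i a. a \<in> carrier M \<Longrightarrow> component M i a = p i a"
proof -
  interpret abelian_group M by fact
  have car: "a \<in> carrier M" if "a \<in> comp M i" for a i
    by (rule additive_subgroup.a_Hcarr[OF assms(2) that])
  have pcar: "p i a \<in> carrier M" if "a \<in> carrier M" for a i
    by (rule car[OF assms(3)[OF that]])
  have ex: "homogeneous_decomp M (\<lambda>i. p i a) a" if a: "a \<in> carrier M" for a
  proof -
    obtain S where S: "finite S" "\<forall>i. i \<notin> S \<longrightarrow> p i a = \<zero>\<^bsub>M\<^esub>" "a = (\<Oplus>\<^bsub>M\<^esub>i\<in>S. p i a)"
      using assms(6)[OF a] by blast
    have sub: "{i. p i a \<noteq> \<zero>\<^bsub>M\<^esub>} \<subseteq> S" using S by auto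
    have "(\<Oplus>\<^bsub>M\<^esub>i\<in>{i. p i a \<noteq> \<zero>\<^bsub>M\<^esub>}. p i a) = (\<Oplus>\<^bsub>M\<^esub>i\<in>S. p i a)"
      by (rule add.finprod_mono_neutral_cong_left) (use sub S(1) pcar[OF a] in auto)
    with S(3) have "a = (\<Oplus>\<^bsub>M\<^esub>i\<in>{i. p i a \<noteq> \<zero>\<^bsub>M\<^esub>}. p i a)" by metis
    then show ?thesis
      unfolding homogeneous_decomp_def
      using finite_subset[OF sub S(1)] assms(3)[OF a] by blast
  qed
  \<comment> \<open>Applying \<open>p j\<close> to any decomposition keeps the summand of degree
    \<open>j\<close> and kills the others, so the summands are forced.\<close>
  have un: "f = (\<lambda>i. p i a)" if f: "homogeneous_decomp M f a" for f a
  proof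
    fix j
    let ?S = "{i. f i \<noteq> \<zero>\<^bsub>M\<^esub>}"
    have fc: "f i \<in> comp M i" and fin: "finite ?S" and a: "a = (\<Oplus>\<^bsub>M\<^esub>i\<in>?S. f i)" for i
      using f unfolding homogeneous_decomp_def by auto
    have fcar: "f i \<in> carrier M" for i by (rule car[OF fc])
    have p0: "p j \<zero>\<^bsub>M\<^esub> = \<zero>\<^bsub>M\<^esub>"
      by (rule additive_zero[OF assms(1,1), of "p j"]) (use pcar assms(4) in auto)
    have *: "finite S \<Longrightarrow> p j (\<Oplus>\<^bsub>M\<^esub>i\<in>S. f i) = (\<Oplus>\<^bsub>M\<^esub>i\<in>S. p j (f i))" for S
      by (induction S rule: finite_induct)
        (simp_all add: p0 fcar pcar assms(4) finsum_closed Pi_def)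
    have "p j a = (\<Oplus>\<^bsub>M\<^esub>i\<in>?S. p j (f i))" using *[OF fin] a by simp
    also have "\<dots> = (\<Oplus>\<^bsub>M\<^esub>i\<in>?S. if j = i then f i else \<zero>\<^bsub>M\<^esub>)"
      using assms(5)[OF fc] by simp
    also have "\<dots> = f j"
    proof (cases "j \<in> ?S")
      case True
      then show ?thesis using fin fcar finsum_singleton[of j ?S f] by auto
    next
      case False
      have "(\<Oplus>\<^bsub>M\<^esub>i\<in>?S. if j = i then f i else \<zero>\<^bsub>M\<^esub>) = (\<Oplus>\<^bsub>M\<^esub>i\<in>?S. \<zero>\<^bsub>M\<^esub>)"
        by (rule finsum_cong') (use False in auto)
      then show ?thesis using False by simp
    qed
    finally show "f j = p j a" ..
  qed
  have "\<exists>!f. homogeneous_decomp M f a" if "a \<in> carrier M" for a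
    by (rule ex1I[where P = "\<lambda>f. homogeneous_decomp M f a", OF ex[OF that] un])
  then show *: "graded_group M"
    by (intro graded_group.intro graded_group_axioms.intro assms(1,2))
  show "component M i a = p i a" if "a \<in> carrier M" for i a
    using graded_group.component_unique[OF * ex[OF that]] .
qed

section \<open>Quotients\<close>

lemma (in abelian_subgroup) coset_absorb:
  assumes "h \<in> H" "x \<in> carrier G"
  shows "H +> (h \<oplus> x) = H +> x"
  using assms a_repr_independence'[of "h \<oplus> x" x] by (auto simp: a_r_coset_def')

lemma (in abelian_subgroup) coset_eq_zero_iff:
  assumes "x \<in> carrier G"
  shows "H +> x = H \<longleftrightarrow> x \<in> H"
  using assms a_rcos_self a_rcos_const by blast

text \<open>Changing a representative by an element \<open>h\<close> of \<open>H\<close> changes its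
  image by \<open>T h\<close>, again in \<open>H\<close>; so all cosets in the union
  coincide.\<close>

lemma (in abelian_subgroup) Union_cosets:
  assumes "x \<in> carrier G"
    and "\<And>a. a \<in> carrier G \<Longrightarrow> T a \<in> carrier G"
    and "\<And>a b. \<lbrakk>a \<in> carrier G; b \<in> carrier G\<rbrakk> \<Longrightarrow> T (a \<oplus> b) = T a \<oplus> T b"
    and "\<And>h. h \<in> H \<Longrightarrow> T h \<in> H"
  shows "(\<Union>a\<in>H +> x. H +> T a) = H +> T x"
proof -
  have "H +> T a = H +> T x" if a: "a \<in> H +> x" for a
  proof -
    obtain h where "h \<in> H" "a = h \<oplus> x" using a by (auto simp: a_r_coset_def')
    then show ?thesis using assms coset_absorb[of "T h" "T x"] by simp
  qed
  then show ?thesis using a_rcos_self[OF assms(1)] by blast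
qed

lemma (in abelian_subgroup) Union_cosets2:
  assumes "x \<in> carrier G" "y \<in> carrier G"
    and "\<And>a b. \<lbrakk>a \<in> carrier G; b \<in> carrier G\<rbrakk> \<Longrightarrow> T a b \<in> carrier G"
    and "\<And>a a' b. \<lbrakk>a \<in> carrier G; a' \<in> carrier G; b \<in> carrier G\<rbrakk> \<Longrightarrow> T (a \<oplus> a') b = T a b \<oplus> T a' b"
    and "\<And>a b b'. \<lbrakk>a \<in> carrier G; b \<in> carrier G; b' \<in> carrier G\<rbrakk> \<Longrightarrow> T a (b \<oplus> b') = T a b \<oplus> T a b'"
    and "\<And>a h. \<lbrakk>a \<in> carrier G; h \<in> H\<rbrakk> \<Longrightarrow> T a h \<in> H"
    and "\<And>a h. \<lbrakk>a \<in> carrier G; h \<in> H\<rbrakk> \<Longrightarrow> T h a \<in> H"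
  shows "(\<Union>a\<in>H +> x. \<Union>b\<in>H +> y. H +> T a b) = H +> T x y"
proof -
  have "(\<Union>b\<in>H +> y. H +> T a b) = H +> T a y" if "a \<in> H +> x" for a
    using that a_elemrcos_carrier[OF assms(1)] assms
    by (intro Union_cosets) auto
  then have "(\<Union>a\<in>H +> x. \<Union>b\<in>H +> y. H +> T a b) = (\<Union>a\<in>H +> x. H +> T a y)"
    by simp
  also have "\<dots> = H +> T x y"
    using assms by (intro Union_cosets) auto
  finally show ?thesis .
qed

text \<open>The last assumption says that the kernel of \<open>\<pi>\<close> is homogeneous, which
  is what lets a grading descend. \<open>\<pi>\<close> stays abstract because quotient algebras and
  quotient modules are different records; even the group laws of \<open>Q\<close> are transported
  along it.\<close>

lemma graded_group_image:
  assumes "graded_group M"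
    and "carrier Q = \<pi> ` carrier M" "\<zero>\<^bsub>Q\<^esub> = \<pi> \<zero>\<^bsub>M\<^esub>"
    and "\<And>i. comp Q i = \<pi> ` comp M i"
    and "\<And>a b. \<lbrakk>a \<in> carrier M; b \<in> carrier M\<rbrakk> \<Longrightarrow> \<pi> (a \<oplus>\<^bsub>M\<^esub> b) = \<pi> a \<oplus>\<^bsub>Q\<^esub> \<pi> b"
    and "\<And>i a. \<lbrakk>a \<in> carrier M; \<pi> a = \<zero>\<^bsub>Q\<^esub>\<rbrakk> \<Longrightarrow> \<pi> (component M i a) = \<zero>\<^bsub>Q\<^esub>"
  shows "graded_group Q"
    and "\<And>i a. a \<in> carrier M \<Longrightarrow> component Q i (\<pi> a) = \<pi> (component M i a)"
proof -
  interpret M: graded_group M by fact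
  have ab: "abelian_group Q"
  proof (rule abelian_groupI)
    fix x assume "x \<in> carrier Q"
    then obtain a where a: "a \<in> carrier M" "x = \<pi> a" using assms(2) by auto
    then have "\<pi> (\<ominus>\<^bsub>M\<^esub> a) \<oplus>\<^bsub>Q\<^esub> x = \<zero>\<^bsub>Q\<^esub>"
      using assms(5)[of "\<ominus>\<^bsub>M\<^esub> a" a] by (simp add: M.l_neg assms(3))
    then show "\<exists>y\<in>carrier Q. y \<oplus>\<^bsub>Q\<^esub> x = \<zero>\<^bsub>Q\<^esub>" using a(1) assms(2) by auto
  qed (auto simp: assms(2,3) assms(5)[symmetric] M.a_ac intro!: imageI)
  interpret Q: abelian_group Q by fact
  have clos: "\<pi> a \<in> carrier Q" if "a \<in> carrier M" for a using that assms(2) by auto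
  have sub: "additive_subgroup (comp Q i) Q" for i
  proof (intro additive_subgroup.intro subgroup.intro)
    show "comp Q i \<subseteq> carrier (add_monoid Q)"
      using M.comp_carrier assms(2,4) by auto
    fix x y assume "x \<in> comp Q i" "y \<in> comp Q i"
    then show "x \<otimes>\<^bsub>add_monoid Q\<^esub> y \<in> comp Q i"
      using assms(4,5) M.comp_carrier M.comp_add by (auto simp: assms(5)[symmetric] intro!: imageI)
  next
    show "\<one>\<^bsub>add_monoid Q\<^esub> \<in> comp Q i" using M.comp_zero by (auto simp: assms(3,4))
  next
    fix x assume "x \<in> comp Q i"
    then obtain a where a: "a \<in> comp M i" "x = \<pi> a" using assms(4) by auto
    have "\<pi> (\<ominus>\<^bsub>M\<^esub> a) = \<ominus>\<^bsub>Q\<^esub> \<pi> a"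
      using additive_minus[OF M.abelian_group_axioms ab, of \<pi>] clos assms(5) M.comp_carrier[OF a(1)]
      by blast
    then show "inv\<^bsub>add_monoid Q\<^esub> x \<in> comp Q i"
      using a M.comp_minus assms(4) by (metis a_inv_def imageI)
  qed
  \<comment> \<open>Components of \<open>x\<close> are read off an arbitrary preimage; the next fact
    shows that the choice is immaterial.\<close>
  define p where "p i x = \<pi> (component M i (SOME a. a \<in> carrier M \<and> \<pi> a = x))" for i x
  have p: "p i (\<pi> a) = \<pi> (component M i a)" if a: "a \<in> carrier M" for i a
  proof -
    define b where "b = (SOME b. b \<in> carrier M \<and> \<pi> b = \<pi> a)"
    have b: "b \<in> carrier M" "\<pi> b = \<pi> a"
      using someI[of "\<lambda>b. b \<in> carrier M \<and> \<pi> b = \<pi> a", OF conjI[OF a refl]]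
      by (auto simp: b_def)
    \<comment> \<open>The difference of two preimages lies in the kernel, hence so do its
      components.\<close>
    let ?e = "\<ominus>\<^bsub>M\<^esub> b \<oplus>\<^bsub>M\<^esub> a"
    have e: "?e \<in> carrier M" "b \<oplus>\<^bsub>M\<^esub> ?e = a" using a b(1) by (simp_all add: M.a_assoc[symmetric] M.r_neg)
    have "\<pi> b \<oplus>\<^bsub>Q\<^esub> \<pi> ?e = \<pi> b" using assms(5)[OF b(1) e(1)] e(2) b(2) by simp
    then have "\<pi> ?e = \<zero>\<^bsub>Q\<^esub>" using clos b(1) e(1) by simp
    then have "\<pi> (component M i ?e) = \<zero>\<^bsub>Q\<^esub>" using assms(6) e(1) by simp
    moreover have "\<pi> (component M i a) = \<pi> (component M i b) \<oplus>\<^bsub>Q\<^esub> \<pi> (component M i ?e)"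
      using M.component_add[OF b(1) e(1), of i] e b(1) by (simp add: assms(5) M.component_closed)
    ultimately show ?thesis
      unfolding p_def b_def[symmetric] using clos b(1) M.component_closed by simp
  qed
  have sum: "\<pi> (\<Oplus>\<^bsub>M\<^esub>i\<in>S. f i) = (\<Oplus>\<^bsub>Q\<^esub>i\<in>S. \<pi> (f i))"
    if "finite S" "\<And>i. f i \<in> carrier M" for S :: "int set" and f
    using that(1)
    by (induction S rule: finite_induct)
      (simp_all add: that(2) assms(3,5) clos M.finsum_closed Pi_def)
  have ex: "\<exists>S. finite S \<and> (\<forall>i. i \<notin> S \<longrightarrow> p i x = \<zero>\<^bsub>Q\<^esub>) \<and> x = (\<Oplus>\<^bsub>Q\<^esub>i\<in>S. p i x)"
    if x: "x \<in> carrier Q" for x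
  proof -
    obtain a where a: "a \<in> carrier M" "x = \<pi> a" using x assms(2) by auto
    let ?S = "{i. component M i a \<noteq> \<zero>\<^bsub>M\<^esub>}"
    have "x = \<pi> (\<Oplus>\<^bsub>M\<^esub>i\<in>?S. component M i a)"
      using M.finsum_component[OF a(1) M.finite_component[OF a(1)] subset_refl] a(2) by metis
    also have "\<dots> = (\<Oplus>\<^bsub>Q\<^esub>i\<in>?S. p i x)"
      using sum[OF M.finite_component[OF a(1)] M.component_closed[OF a(1)]] p[OF a(1)] a(2) by simp
    finally have "x = (\<Oplus>\<^bsub>Q\<^esub>i\<in>?S. p i x)" .
    moreover have "\<forall>i. i \<notin> ?S \<longrightarrow> p i x = \<zero>\<^bsub>Q\<^esub>" using p a assms(3) by simp
    ultimately show ?thesis using M.finite_component[OF a(1)] by blast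
  qed
  have pc: "p i x \<in> comp Q i" if "x \<in> carrier Q" for i x
    using that p M.component_comp by (auto simp: assms(2,4))
  have pa: "p i (x \<oplus>\<^bsub>Q\<^esub> y) = p i x \<oplus>\<^bsub>Q\<^esub> p i y" if "x \<in> carrier Q" "y \<in> carrier Q" for i x y
    using that p M.component_add M.component_closed by (auto simp: assms(2) assms(5)[symmetric])
  have ph: "p i x = (if i = j then x else \<zero>\<^bsub>Q\<^esub>)" if "x \<in> comp Q j" for i j x
    using that p M.component_homogeneous M.comp_carrier by (auto simp: assms(3,4))
  show "graded_group Q" by (rule graded_groupI(1)[of Q p]) (fact ab sub pc pa ph ex)+
  show "component Q i (\<pi> a) = \<pi> (component M i a)" if "a \<in> carrier M" for i a
  proof -
    have "component Q i (\<pi> a) = p i (\<pi> a)"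
      by (rule graded_groupI(2)[of Q p]) (fact ab sub pc pa ph ex clos[OF that])+
    then show ?thesis using p[OF that] by simp
  qed
qed

lemma (in additive_subgroup) abelian_subgroup: "abelian_group G \<Longrightarrow> abelian_subgroup H G"
  by (rule abelian_subgroupI3[OF additive_subgroup_axioms])

section \<open>Stability of DG Poisson ideals and quotient algebras\<close>

context dg_poisson_algebra
begin

lemma differential_closed: "a \<in> carrier A \<Longrightarrow> differential A a \<in> carrier A"
proof (induction rule: Vec.graded_induct)
  case (homogeneous i b)
  then show ?case using differential_comp Vec.comp_carrier by blast
next
  case (add b c)
  then show ?case by (simp add: differential_add)
qed

lemma bracket_closed:
  assumes "a \<in> carrier A" "b \<in> carrier A"
  shows "bracket A a b \<in> carrier A"
  using assms(1)
proof (induction rule: Vec.graded_induct)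
  case (homogeneous i a)
  show ?case
    using assms(2)
  proof (induction rule: Vec.graded_induct)
    case (homogeneous j b)
    show ?case using bracket_comp[OF \<open>a \<in> comp A i\<close> homogeneous] Vec.comp_carrier by blast
  next
    case (add b c)
    then show ?case using Vec.comp_carrier[OF homogeneous] by (simp add: bracket_add_right)
  qed
next
  case (add a c)
  then show ?case using assms(2) by (simp add: bracket_add_left)
qed

lemma ideal_abelian_subgroup: "ideal I A \<Longrightarrow> abelian_subgroup I A"
  using ideal.axioms(1) additive_subgroup.abelian_subgroup Alg.is_abelian_group by blast

text \<open>The definition bounds brackets with the ideal in the first slot. Antisymmetry moves it
  to the second, but only for homogeneous arguments, so homogeneity of \<open>I\<close> is used to
  keep the components of \<open>b\<close> inside \<open>I\<close>.\<close>

lemma bracket_ideal_right: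
  assumes "dg_poisson_ideal I A" "a \<in> carrier A" "b \<in> I"
  shows "bracket A a b \<in> I"
proof -
  interpret ideal I A using assms(1) by (simp add: dg_poisson_ideal_def dg_ideal_def)
  have H: "I \<subseteq> carrier A" "\<And>i. component A i b \<in> I" and b: "b \<in> carrier A"
    using assms(1,3) Vec.homogeneous_subset_iff by (auto simp: dg_poisson_ideal_def dg_ideal_def)
  show ?thesis
    using b H(2)
  proof (rule Vec.graded_induct_subset)
    fix j b assume b: "b \<in> comp A j" "b \<in> I"
    show "bracket A a b \<in> I"
      using assms(2)
    proof (induction rule: Vec.graded_induct)
      case (homogeneous i a)
      then have "bracket A b a \<in> I"
        using assms(1) b(2) Vec.comp_carrier by (auto simp: dg_poisson_ideal_def)
      then show ?case
        by (simp add: bracket_antisym[OF homogeneous b(1)] koszul_def)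
    next
      case (add a c)
      then show ?case using H b by (auto simp: bracket_add_left)
    qed
  qed (use assms(2) in \<open>auto simp: bracket_add_right\<close>)
qed

end

lemma quot_dg_poisson_simps:
  "carrier (quot_dg_poisson A I) = (\<lambda>a. I +>\<^bsub>A\<^esub> a) ` carrier A"
  "\<zero>\<^bsub>quot_dg_poisson A I\<^esub> = I"
  "\<one>\<^bsub>quot_dg_poisson A I\<^esub> = I +>\<^bsub>A\<^esub> \<one>\<^bsub>A\<^esub>"
  "comp (quot_dg_poisson A I) i = (\<lambda>a. I +>\<^bsub>A\<^esub> a) ` comp A i"
  by (auto simp: quot_dg_poisson_def add_dg_poisson_def quot_graded_def quot_algebra_def
      FactRing_def A_RCOSETS_def' ring.defs module.defs graded.defs dg.defs dg_poisson.defs)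

text \<open>Once the unions of cosets collapse, every operation on classes is the class of the
  operation on representatives, and each axiom is \<open>\<pi>\<close> applied to the axiom of
  \<open>R\<close>.\<close>

lemma dg_poisson_algebra_quotient:
  assumes "dg_poisson_algebra K R" "dg_poisson_ideal I R"
  shows "dg_poisson_algebra K (quot_dg_poisson R I)"
proof -
  interpret dg_poisson_algebra K R by fact
  interpret ideal I R using assms(2) by (simp add: dg_poisson_ideal_def dg_ideal_def)
  interpret abelian_subgroup I R using ideal_abelian_subgroup is_ideal by blast
  define Q where "Q = quot_dg_poisson R I"
  define \<pi> where "\<pi> a = I +>\<^bsub>R\<^esub> a" for a
  note Q = quot_dg_poisson_simps[of R I, folded Q_def \<pi>_def]
  have I: "I \<subseteq> carrier R" "\<And>a. a \<in> I \<Longrightarrow> differential R a \<in> I"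
      "\<And>a b. \<lbrakk>a \<in> I; b \<in> carrier R\<rbrakk> \<Longrightarrow> bracket R a b \<in> I"
      "\<And>i a. a \<in> I \<Longrightarrow> component R i a \<in> I"
    using assms(2) Vec.homogeneous_subset_iff
    by (auto simp: dg_poisson_ideal_def dg_ideal_def)
  have car: "a \<in> carrier R" if "a \<in> comp R i" for a i using that Vec.comp_carrier by blast
  note clos = differential_closed bracket_closed Vec.koszul_closed
  have op: "\<pi> a \<oplus>\<^bsub>Q\<^esub> \<pi> b = \<pi> (a \<oplus>\<^bsub>R\<^esub> b)" "\<pi> a \<otimes>\<^bsub>Q\<^esub> \<pi> b = \<pi> (a \<otimes>\<^bsub>R\<^esub> b)"
    "differential Q (\<pi> a) = \<pi> (differential R a)"
    "bracket Q (\<pi> a) (\<pi> b) = \<pi> (bracket R a b)"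
    if "a \<in> carrier R" "b \<in> carrier R" for a b
  proof -
    show "\<pi> a \<oplus>\<^bsub>Q\<^esub> \<pi> b = \<pi> (a \<oplus>\<^bsub>R\<^esub> b)" "\<pi> a \<otimes>\<^bsub>Q\<^esub> \<pi> b = \<pi> (a \<otimes>\<^bsub>R\<^esub> b)"
      using that a_rcos_sum rcoset_mult_add
      by (auto simp: \<pi>_def Q_def quot_dg_poisson_def add_dg_poisson_def quot_graded_def
          quot_algebra_def FactRing_def ring.defs module.defs graded.defs dg.defs dg_poisson.defs)
    have "(\<Union>x\<in>I +>\<^bsub>R\<^esub> a. I +>\<^bsub>R\<^esub> differential R x) = I +>\<^bsub>R\<^esub> differential R a"
      by (rule Union_cosets) (use that clos differential_add I in auto)
    then show "differential Q (\<pi> a) = \<pi> (differential R a)"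
      by (simp add: \<pi>_def Q_def quot_dg_poisson_def add_dg_poisson_def quot_graded_def
          quot_algebra_def FactRing_def ring.defs module.defs graded.defs dg.defs dg_poisson.defs)
    have "(\<Union>x\<in>I +>\<^bsub>R\<^esub> a. \<Union>y\<in>I +>\<^bsub>R\<^esub> b. I +>\<^bsub>R\<^esub> bracket R x y) = I +>\<^bsub>R\<^esub> bracket R a b"
      by (rule Union_cosets2)
        (use that clos bracket_add_left bracket_add_right I bracket_ideal_right[OF assms(2)] in auto)
    then show "bracket Q (\<pi> a) (\<pi> b) = \<pi> (bracket R a b)"
      by (simp add: \<pi>_def Q_def quot_dg_poisson_def add_dg_poisson_def quot_graded_def
          quot_algebra_def FactRing_def ring.defs module.defs graded.defs dg.defs dg_poisson.defs)
  qed
  have smult: "c \<odot>\<^bsub>Q\<^esub> \<pi> a = \<pi> (c \<odot>\<^bsub>R\<^esub> a)" if "c \<in> carrier K" "a \<in> carrier R" for c a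
  proof -
    \<comment> \<open>An ideal is closed under ring multiplication; closure under scalars follows
      because \<open>c\<close> acts as multiplication by \<open>c\<close> times the unit.\<close>
    have "c \<odot>\<^bsub>R\<^esub> h \<in> I" if "h \<in> I" for h
    proof -
      have "c \<odot>\<^bsub>R\<^esub> h = (c \<odot>\<^bsub>R\<^esub> \<one>\<^bsub>R\<^esub>) \<otimes>\<^bsub>R\<^esub> h"
        using smult_mult_left[of c "\<one>\<^bsub>R\<^esub>" h] that I \<open>c \<in> carrier K\<close> by auto
      then show ?thesis using that \<open>c \<in> carrier K\<close> by (simp add: I_l_closed)
    qed
    then have "(\<Union>x\<in>I +>\<^bsub>R\<^esub> a. I +>\<^bsub>R\<^esub> (c \<odot>\<^bsub>R\<^esub> x)) = I +>\<^bsub>R\<^esub> (c \<odot>\<^bsub>R\<^esub> a)"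
      by (intro Union_cosets) (use that Vec.smult_r_distr in auto)
    then show ?thesis
      by (simp add: \<pi>_def Q_def quot_dg_poisson_def add_dg_poisson_def quot_graded_def
          quot_algebra_def FactRing_def ring.defs module.defs graded.defs dg.defs dg_poisson.defs)
  qed
  have zero: "\<zero>\<^bsub>Q\<^esub> = \<pi> \<zero>\<^bsub>R\<^esub>"
    using coset_eq_zero_iff[of "\<zero>\<^bsub>R\<^esub>"] by (simp add: Q \<pi>_def)
  have kernel: "\<pi> (component R i a) = \<zero>\<^bsub>Q\<^esub>" if "a \<in> carrier R" "\<pi> a = \<zero>\<^bsub>Q\<^esub>" for i a
    using that I(4) by (simp add: Q \<pi>_def coset_eq_zero_iff Vec.component_closed)
  interpret gQ: graded_group Q
    by (rule graded_group_image[of R Q \<pi>])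
      (use Vec.graded_group_axioms op kernel zero in \<open>auto simp: Q(1,4)\<close>)
  have kos: "koszul Q k (\<pi> a) = \<pi> (koszul R k a)" "\<ominus>\<^bsub>Q\<^esub> \<pi> a = \<pi> (\<ominus>\<^bsub>R\<^esub> a)" if "a \<in> carrier R" for k a
    using additive_koszul[OF Vec.abelian_group_axioms gQ.abelian_group_axioms, of \<pi>]
      additive_minus[OF Vec.abelian_group_axioms gQ.abelian_group_axioms, of \<pi>] op that Q(1)
    by auto
  note simps = Q(1,3,4) op(1,2,4) op(3)[OF _ Alg.one_closed] smult kos car clos
  have ring: "ring Q"
  proof (rule ringI)
    show "monoid Q"
      by (rule monoidI) (auto simp: simps Alg.m_assoc)
  qed (auto simp: simps Alg.l_distr Alg.r_distr intro: gQ.abelian_group_axioms)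
  have "dg_poisson_algebra K Q"
    by (intro dg_poisson_algebra.intro graded_algebra.intro graded_vector_space.intro
        graded_vector_space_axioms.intro graded_algebra_axioms.intro dg_poisson_algebra_axioms.intro
        moduleI ring gQ.graded_group_axioms gQ.abelian_group_axioms field_axioms is_cring)
      (auto simp: simps Vec.smult_l_distr Vec.smult_r_distr Vec.smult_assoc1
       smult_mult_left smult_mult_right differential_add differential_smult differential_square zero
       bracket_add_left bracket_add_right bracket_smult_left bracket_smult_right
       del: equalityI
       intro!: imageI smult_comp one_comp mult_comp differential_comp bracket_comp
         arg_cong[where f = \<pi>] graded_commutative differential_mult bracket_antisym
         bracket_jacobi bracket_leibniz differential_bracket)
  then show ?thesis unfolding Q_def .
qed

section \<open>Quotients of DG Poisson modules\<close>

definition quot_dg_poisson_mod ::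
    "('a, 'm, 'y) dg_poisson_mod_scheme \<Rightarrow> 'm set \<Rightarrow> ('a, 'm set) dg_poisson_mod" where
  "quot_dg_poisson_mod M N =
     \<lparr>carrier = (\<lambda>m. N +>\<^bsub>M\<^esub> m) ` carrier M, mult = undefined, one = undefined,
      zero = N, add = set_add M,
      smult = (\<lambda>a X. \<Union>m\<in>X. N +>\<^bsub>M\<^esub> (a \<odot>\<^bsub>M\<^esub> m)),
      comp = (\<lambda>i. (\<lambda>m. N +>\<^bsub>M\<^esub> m) ` comp M i),
      differential = (\<lambda>X. \<Union>m\<in>X. N +>\<^bsub>M\<^esub> differential M m),
      mbracket = (\<lambda>a X. \<Union>m\<in>X. N +>\<^bsub>M\<^esub> mbracket M a m)\<rparr>"

context dg_poisson_module
begin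

lemma mdiff_closed: "m \<in> carrier M \<Longrightarrow> differential M m \<in> carrier M"
proof (induction rule: Mod.graded_induct)
  case (homogeneous i b)
  then show ?case using mdiff_comp Mod.comp_carrier by blast
next
  case (add b c)
  then show ?case by (simp add: mdiff_add)
qed

lemma mbracket_closed:
  assumes "a \<in> carrier A" "m \<in> carrier M"
  shows "mbracket M a m \<in> carrier M"
  using assms(1)
proof (induction rule: Vec.graded_induct)
  case (homogeneous i a)
  show ?case
    using assms(2)
  proof (induction rule: Mod.graded_induct)
    case (homogeneous j b)
    show ?case using mbracket_comp[OF \<open>a \<in> comp A i\<close> homogeneous] Mod.comp_carrier by blast
  next
    case (add b c)
    then show ?case using Vec.comp_carrier[OF homogeneous] by (simp add: mbracket_add_right)
  qed
next
  case (add a c)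
  then show ?case using assms(2) by (simp add: mbracket_add_left)
qed

lemma act_zero: "a \<in> carrier A \<Longrightarrow> a \<odot>\<^bsub>M\<^esub> \<zero>\<^bsub>M\<^esub> = \<zero>\<^bsub>M\<^esub>"
  by (rule additive_zero[of M M "\<lambda>m. a \<odot>\<^bsub>M\<^esub> m"])
    (use Mod.abelian_group_axioms act_closed act_add_right in auto)

lemma zero_act: "m \<in> carrier M \<Longrightarrow> \<zero>\<^bsub>A\<^esub> \<odot>\<^bsub>M\<^esub> m = \<zero>\<^bsub>M\<^esub>"
  by (rule additive_zero[of A M "\<lambda>a. a \<odot>\<^bsub>M\<^esub> m"])
    (use Vec.abelian_group_axioms Mod.abelian_group_axioms act_closed act_add_left in auto)

lemma mdiff_zero: "differential M \<zero>\<^bsub>M\<^esub> = \<zero>\<^bsub>M\<^esub>"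
  by (rule additive_zero[of M M "differential M"])
    (use Mod.abelian_group_axioms mdiff_closed mdiff_add in auto)

lemma mbracket_zero: "a \<in> carrier A \<Longrightarrow> mbracket M a \<zero>\<^bsub>M\<^esub> = \<zero>\<^bsub>M\<^esub>"
  by (rule additive_zero[of M M "mbracket M a"])
    (use Mod.abelian_group_axioms mbracket_closed mbracket_add_right in auto)

context
  fixes N
  assumes N: "dg_poisson_submodule N A M"
begin

lemma submodule_facts:
  shows "N \<subseteq> carrier M" "\<And>m. m \<in> N \<Longrightarrow> differential M m \<in> N"
    "\<And>a m. \<lbrakk>a \<in> carrier A; m \<in> N\<rbrakk> \<Longrightarrow> a \<odot>\<^bsub>M\<^esub> m \<in> N"
    "\<And>a m. \<lbrakk>a \<in> carrier A; m \<in> N\<rbrakk> \<Longrightarrow> mbracket M a m \<in> N"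
    "\<And>i m. m \<in> N \<Longrightarrow> component M i m \<in> N"
  using N Mod.homogeneous_subset_iff submodule.smult_closed
  by (auto simp: dg_poisson_submodule_def)

lemma submodule_abelian_subgroup: "abelian_subgroup N M"
proof -
  have "submodule N A M" using N by (simp add: dg_poisson_submodule_def)
  from additive_subgroup.intro[OF submodule.axioms(1)[OF this]]
  show ?thesis using additive_subgroup.abelian_subgroup Mod.abelian_group_axioms by blast
qed

interpretation abelian_subgroup N M by (rule submodule_abelian_subgroup)

private abbreviation (input) "Q \<equiv> quot_dg_poisson_mod M N"
private abbreviation (input) "\<pi> \<equiv> (+>\<^bsub>M\<^esub>) N"

lemma quot_mod_carrier: "carrier Q = \<pi> ` carrier M"
  and quot_mod_zero: "\<zero>\<^bsub>Q\<^esub> = N"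
  and quot_mod_comp: "comp Q i = \<pi> ` comp M i"
  by (simp_all add: quot_dg_poisson_mod_def)

lemma quot_mod_add:
  "\<lbrakk>m \<in> carrier M; m' \<in> carrier M\<rbrakk> \<Longrightarrow> \<pi> m \<oplus>\<^bsub>Q\<^esub> \<pi> m' = \<pi> (m \<oplus>\<^bsub>M\<^esub> m')"
  by (simp add: quot_dg_poisson_mod_def a_rcos_sum)

lemma quot_mod_smult:
  "\<lbrakk>a \<in> carrier A; m \<in> carrier M\<rbrakk> \<Longrightarrow> a \<odot>\<^bsub>Q\<^esub> \<pi> m = \<pi> (a \<odot>\<^bsub>M\<^esub> m)"
  unfolding quot_dg_poisson_mod_def module.simps
  by (rule Union_cosets) (use act_closed act_add_right submodule_facts in auto)

lemma quot_mod_differential: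
  "m \<in> carrier M \<Longrightarrow> differential Q (\<pi> m) = \<pi> (differential M m)"
  unfolding quot_dg_poisson_mod_def dg.simps
  by (rule Union_cosets) (use mdiff_closed mdiff_add submodule_facts in auto)

lemma quot_mod_mbracket:
  "\<lbrakk>a \<in> carrier A; m \<in> carrier M\<rbrakk> \<Longrightarrow> mbracket Q a (\<pi> m) = \<pi> (mbracket M a m)"
  unfolding quot_dg_poisson_mod_def dg_poisson_mod.simps
  by (rule Union_cosets) (use mbracket_closed mbracket_add_right submodule_facts in auto)

lemma quot_mod_eq_zero: "m \<in> carrier M \<Longrightarrow> \<pi> m = N \<longleftrightarrow> m \<in> N"
  by (rule coset_eq_zero_iff)

lemma quot_mod_graded:
  shows "graded_group Q"
    and "m \<in> carrier M \<Longrightarrow> component Q i (\<pi> m) = \<pi> (component M i m)"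
proof -
  have z: "\<zero>\<^bsub>Q\<^esub> = \<pi> \<zero>\<^bsub>M\<^esub>"
    using quot_mod_eq_zero[of "\<zero>\<^bsub>M\<^esub>"] by (simp add: quot_mod_zero)
  have k: "\<pi> (component M i m) = \<zero>\<^bsub>Q\<^esub>" if "m \<in> carrier M" "\<pi> m = \<zero>\<^bsub>Q\<^esub>" for i m
    using that submodule_facts(5)
    by (simp add: quot_mod_zero quot_mod_eq_zero Mod.component_closed)
  show "graded_group Q"
    by (rule graded_group_image(1)[of M Q \<pi>])
      (auto simp: quot_mod_carrier quot_mod_comp quot_mod_add z k
          simp flip: z intro: Mod.graded_group_axioms)
  show "m \<in> carrier M \<Longrightarrow> component Q i (\<pi> m) = \<pi> (component M i m)"
    by (rule graded_group_image(2)[of M Q \<pi>])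
      (auto simp: quot_mod_carrier quot_mod_comp quot_mod_add z k
          simp flip: z intro: Mod.graded_group_axioms)
qed

lemma dg_poisson_module_quotient: "dg_poisson_module K A Q"
proof -
  interpret gQ: graded_group Q by (rule quot_mod_graded)
  have zero: "\<zero>\<^bsub>Q\<^esub> = \<pi> \<zero>\<^bsub>M\<^esub>"
    using quot_mod_eq_zero[of "\<zero>\<^bsub>M\<^esub>"] by (simp add: quot_mod_zero)
  have kos: "koszul Q k (\<pi> a) = \<pi> (koszul M k a)" if "a \<in> carrier M" for k a
    using additive_koszul[OF Mod.abelian_group_axioms gQ.abelian_group_axioms, of \<pi>]
      that by (auto simp: quot_mod_carrier quot_mod_add)
  have base: "base_smult A M c m \<in> carrier M" "base_smult A Q c (\<pi> m) = \<pi> (base_smult A M c m)"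
    if "c \<in> carrier K" "m \<in> carrier M" for c m
    using that by (auto simp: base_smult_def quot_mod_smult act_closed)
  note simps = quot_mod_carrier quot_mod_comp quot_mod_add quot_mod_smult quot_mod_differential
    quot_mod_mbracket kos Vec.comp_carrier Mod.comp_carrier act_closed mdiff_closed mbracket_closed
    Mod.koszul_closed base differential_closed bracket_closed
  show ?thesis
    by (intro dg_poisson_module.intro graded_left_module.intro graded_left_module_axioms.intro
        dg_poisson_module_axioms.intro dg_poisson_algebra_axioms graded_algebra_axioms
        gQ.graded_group_axioms)
      (auto simp: simps zero act_add_left act_add_right act_mult act_one
       mdiff_add mdiff_smult mdiff_square mbracket_add_left mbracket_add_right
       mbracket_smult_left mbracket_smult_right
       del: equalityI
       intro!: imageI act_comp mdiff_comp mbracket_comp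
        arg_cong[where f = \<pi>] mdiff_act mbracket_act mbracket_mult mbracket_jacobi mdiff_mbracket)
qed

end

end

section \<open>Simple quotients and annihilators\<close>

text \<open>Makes the sum of an annihilator and a maximal DG ideal a competitor in the definition of
  maximality.\<close>

lemma (in dg_poisson_algebra) dg_ideal_add:
  assumes "dg_ideal I A" "dg_ideal J A"
  shows "dg_ideal (I <+>\<^bsub>A\<^esub> J) A"
proof -
  have sum: "I <+>\<^bsub>A\<^esub> J = {a \<oplus>\<^bsub>A\<^esub> b | a b. a \<in> I \<and> b \<in> J}"
    by (auto simp: set_add_def')
  have I: "I \<subseteq> carrier A" "\<And>i a. a \<in> I \<Longrightarrow> component A i a \<in> I"
      "\<And>a. a \<in> I \<Longrightarrow> differential A a \<in> I"
    and J: "J \<subseteq> carrier A" "\<And>i a. a \<in> J \<Longrightarrow> component A i a \<in> J"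
      "\<And>a. a \<in> J \<Longrightarrow> differential A a \<in> J"
    using assms Vec.homogeneous_subset_iff by (auto simp: dg_ideal_def)
  have "component A i x \<in> I <+>\<^bsub>A\<^esub> J" "differential A x \<in> I <+>\<^bsub>A\<^esub> J"
    if x: "x \<in> I <+>\<^bsub>A\<^esub> J" for i x
  proof -
    obtain a b where ab: "x = a \<oplus>\<^bsub>A\<^esub> b" "a \<in> I" "b \<in> J" using x sum by auto
    then have "a \<in> carrier A" "b \<in> carrier A" using I(1) J(1) by auto
    then show "component A i x \<in> I <+>\<^bsub>A\<^esub> J" "differential A x \<in> I <+>\<^bsub>A\<^esub> J"
      using I(2,3)[OF ab(2)] J(2,3)[OF ab(3)] unfolding sum ab(1)
      by (auto simp: Vec.component_add differential_add)
  qed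
  moreover have "I <+>\<^bsub>A\<^esub> J \<subseteq> carrier A"
    using I(1) J(1) unfolding sum by auto
  moreover have "ideal (I <+>\<^bsub>A\<^esub> J) A"
    using assms Alg.add_ideals by (simp add: dg_ideal_def)
  ultimately show ?thesis
    by (simp add: dg_ideal_def Vec.homogeneous_subset_iff)
qed

context dg_poisson_module
begin

lemma minus_act: "\<lbrakk>a \<in> carrier A; m \<in> carrier M\<rbrakk> \<Longrightarrow> (\<ominus>\<^bsub>A\<^esub> a) \<odot>\<^bsub>M\<^esub> m = \<ominus>\<^bsub>M\<^esub> (a \<odot>\<^bsub>M\<^esub> m)"
  by (rule additive_minus[of A M "\<lambda>a. a \<odot>\<^bsub>M\<^esub> m"])
    (use Vec.abelian_group_axioms Mod.abelian_group_axioms act_closed act_add_left in auto)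

text \<open>Closure under negatives comes from the action of minus the unit of
  \<open>A\<close>.\<close>

lemma dg_poisson_submoduleI:
  assumes "N \<subseteq> carrier M" "\<zero>\<^bsub>M\<^esub> \<in> N"
    and "\<And>m m'. \<lbrakk>m \<in> N; m' \<in> N\<rbrakk> \<Longrightarrow> m \<oplus>\<^bsub>M\<^esub> m' \<in> N"
    and "\<And>a m. \<lbrakk>a \<in> carrier A; m \<in> N\<rbrakk> \<Longrightarrow> a \<odot>\<^bsub>M\<^esub> m \<in> N"
    and "\<And>i m. m \<in> N \<Longrightarrow> component M i m \<in> N"
    and "\<And>m. m \<in> N \<Longrightarrow> differential M m \<in> N"
    and "\<And>a m. \<lbrakk>a \<in> carrier A; m \<in> N\<rbrakk> \<Longrightarrow> mbracket M a m \<in> N"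
  shows "dg_poisson_submodule N A M"
proof -
  have "\<ominus>\<^bsub>M\<^esub> m \<in> N" if "m \<in> N" for m
  proof -
    have "m \<in> carrier M" using that assms(1) by auto
    then have "\<ominus>\<^bsub>M\<^esub> m = (\<ominus>\<^bsub>A\<^esub> \<one>\<^bsub>A\<^esub>) \<odot>\<^bsub>M\<^esub> m" by (simp add: minus_act act_one)
    then show ?thesis using assms(4) that by simp
  qed
  then have "submodule N A M"
    using assms
    by (intro submodule.intro subgroup.intro submodule_axioms.intro) (auto simp flip: a_inv_def)
  then show ?thesis
    using assms by (auto simp: dg_poisson_submodule_def Mod.homogeneous_subset_iff)
qed

lemma zero_submodule: "dg_poisson_submodule {\<zero>\<^bsub>M\<^esub>} A M"
  by (rule dg_poisson_submoduleI)
    (auto simp: act_zero mdiff_zero mbracket_zero Mod.component_zero)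

lemma submodule_closed:
  assumes "dg_poisson_submodule N A M"
  shows "\<zero>\<^bsub>M\<^esub> \<in> N" "\<And>m m'. \<lbrakk>m \<in> N; m' \<in> N\<rbrakk> \<Longrightarrow> m \<oplus>\<^bsub>M\<^esub> m' \<in> N"
proof -
  interpret abelian_subgroup N M using submodule_abelian_subgroup[OF assms] .
  show "\<zero>\<^bsub>M\<^esub> \<in> N" "\<And>m m'. \<lbrakk>m \<in> N; m' \<in> N\<rbrakk> \<Longrightarrow> m \<oplus>\<^bsub>M\<^esub> m' \<in> N" by auto
qed

lemma submodule_preimage:
  assumes "dg_poisson_submodule N A M"
    and "dg_poisson_submodule Y A (quot_dg_poisson_mod M N)"
  shows "dg_poisson_submodule {m \<in> carrier M. N +>\<^bsub>M\<^esub> m \<in> Y} A M"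
proof -
  interpret Q: dg_poisson_module K A "quot_dg_poisson_mod M N"
    by (rule dg_poisson_module_quotient[OF assms(1)])
  note N = assms(1)
  note Y = Q.submodule_facts[OF assms(2)] Q.submodule_closed[OF assms(2)]
  have "N +>\<^bsub>M\<^esub> \<zero>\<^bsub>M\<^esub> = N"
    using quot_mod_eq_zero[OF N, of "\<zero>\<^bsub>M\<^esub>"] submodule_closed[OF N] by simp
  then show ?thesis
    using Y
    by (intro dg_poisson_submoduleI)
      (auto simp: quot_mod_zero[OF N] act_closed mdiff_closed mbracket_closed Mod.component_closed
        simp flip: quot_mod_add[OF N] quot_mod_smult[OF N] quot_mod_differential[OF N]
          quot_mod_mbracket[OF N] quot_mod_graded(2)[OF N])
qed

text \<open>The preimage \<open>L\<close> of a submodule of the quotient lies above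
  \<open>N\<close>. If it contains \<open>w\<close>, it is everything because \<open>w\<close>
  generates; if it misses \<open>w\<close>, it equals \<open>N\<close> by the choice of
  \<open>N\<close>.\<close>

lemma simple_quotient:
  assumes N: "dg_poisson_submodule N A M"
    and w: "w \<in> carrier M" "w \<notin> N"
    and max: "\<And>L. \<lbrakk>dg_poisson_submodule L A M; N \<subseteq> L; w \<notin> L\<rbrakk> \<Longrightarrow> L = N"
    and cyclic: "\<And>L. \<lbrakk>dg_poisson_submodule L A M; w \<in> L\<rbrakk> \<Longrightarrow> L = carrier M"
  shows "simple_dg_poisson_module K A (quot_dg_poisson_mod M N)"
  unfolding simple_dg_poisson_module_def
proof (intro conjI allI impI dg_poisson_module_quotient[OF N])
  let ?Q = "quot_dg_poisson_mod M N"
  interpret Q: dg_poisson_module K A ?Q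
    by (rule dg_poisson_module_quotient[OF assms(1)])
  fix Y assume Y: "dg_poisson_submodule Y A ?Q"
  define L where "L = {m \<in> carrier M. N +>\<^bsub>M\<^esub> m \<in> Y}"
  have L: "dg_poisson_submodule L A M"
    unfolding L_def by (rule submodule_preimage[OF N Y])
  have YL: "Y = (\<lambda>m. N +>\<^bsub>M\<^esub> m) ` L"
    using Q.submodule_facts(1)[OF Y] by (auto simp: L_def quot_mod_carrier[OF N])
  have "N \<in> Y" using Q.submodule_closed(1)[OF Y] by (simp add: quot_mod_zero[OF N])
  then have NL: "N \<subseteq> L"
    using submodule_facts(1)[OF N] quot_mod_eq_zero[OF N] by (force simp: L_def)
  show "Y = {\<zero>\<^bsub>?Q\<^esub>} \<or> Y = carrier ?Q"
  proof (cases "w \<in> L")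
    case True
    then show ?thesis using YL cyclic[OF L] by (simp add: quot_mod_carrier[OF N])
  next
    case False
    then have "L = N" using max[OF L NL] by simp
    then have "x = N" if "x \<in> Y" for x
      using YL submodule_facts(1)[OF N] quot_mod_eq_zero[OF N] that by auto
    then have "Y = {N}" using \<open>N \<in> Y\<close> by blast
    then show ?thesis by (simp add: quot_mod_zero[OF N])
  qed
qed

text \<open>For a module generated by \<open>w\<close>, being proper means missing \<open>w\<close>,
  and this condition survives unions of chains.\<close>

lemma ex_simple_quotient:
  assumes w: "w \<in> carrier M" "w \<noteq> \<zero>\<^bsub>M\<^esub>"
    and cyclic: "\<And>L. \<lbrakk>dg_poisson_submodule L A M; w \<in> L\<rbrakk> \<Longrightarrow> L = carrier M"
  shows "\<exists>N. dg_poisson_submodule N A M \<and> w \<notin> N \<and>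
    simple_dg_poisson_module K A (quot_dg_poisson_mod M N)"
proof -
  let ?C = "{N. dg_poisson_submodule N A M \<and> w \<notin> N}"
  have "\<exists>N\<in>?C. \<forall>L\<in>?C. N \<subseteq> L \<longrightarrow> L = N"
  proof (rule subset_Zorn_nonempty)
    show "?C \<noteq> {}" using zero_submodule w(2) by blast
    fix C assume C: "C \<noteq> {}" "subset.chain ?C C"
    then have sub: "dg_poisson_submodule N A M" and "w \<notin> N" if "N \<in> C" for N
      using that by (auto simp: subset.chain_def)
    moreover have "dg_poisson_submodule (\<Union>C) A M"
    proof (rule dg_poisson_submoduleI)
      fix m m' assume "m \<in> \<Union>C" "m' \<in> \<Union>C"
      then obtain X Y where "X \<in> C" "m \<in> X" "Y \<in> C" "m' \<in> Y" by blast
      moreover from this have "X \<subseteq> Y \<or> Y \<subseteq> X" using C(2) by (auto simp: subset_chain_def)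
      ultimately obtain N where "N \<in> C" "m \<in> N" "m' \<in> N" by blast
      then show "m \<oplus>\<^bsub>M\<^esub> m' \<in> \<Union>C" using submodule_closed(2)[OF sub[OF \<open>N \<in> C\<close>]] by blast
    next
      show "\<Union>C \<subseteq> carrier M" using submodule_facts(1)[OF sub] by blast
      obtain N where "N \<in> C" using C(1) by blast
      then show "\<zero>\<^bsub>M\<^esub> \<in> \<Union>C" using submodule_closed(1)[OF sub] by blast
    qed (auto intro: submodule_facts(2-)[OF sub])
    ultimately show "\<Union>C \<in> ?C" by blast
  qed
  then obtain N where "dg_poisson_submodule N A M" "w \<notin> N"
    "\<And>L. \<lbrakk>dg_poisson_submodule L A M; N \<subseteq> L; w \<notin> L\<rbrakk> \<Longrightarrow> L = N" by auto
  then show ?thesis using simple_quotient[OF _ w(1) _ _ cyclic] by blast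
qed

text \<open>For homogeneous \<open>m\<close>, the map from \<open>a\<close> to its product with
  \<open>m\<close> is homogeneous, so each component of \<open>a\<close> applied to \<open>m\<close>
  is a component of that product, which is zero.\<close>

lemma annihilator_component:
  assumes "a \<in> module_annihilator A M"
  shows "component A i a \<in> module_annihilator A M"
proof -
  have a: "a \<in> carrier A" "\<And>m. m \<in> carrier M \<Longrightarrow> a \<odot>\<^bsub>M\<^esub> m = \<zero>\<^bsub>M\<^esub>"
    using assms by (auto simp: module_annihilator_def)
  have "component A i a \<odot>\<^bsub>M\<^esub> m = \<zero>\<^bsub>M\<^esub>" if "m \<in> carrier M" for m
    using that
  proof (induction rule: Mod.graded_induct)
    case (homogeneous j m)
    note m = Mod.comp_carrier[OF homogeneous]
    have "component M (i + j) (a \<odot>\<^bsub>M\<^esub> m) = component A i a \<odot>\<^bsub>M\<^esub> m"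
      by (rule component_additive[OF Vec.graded_group_axioms Mod.graded_group_axioms])
        (use m a(1) act_closed act_add_left act_comp[OF _ homogeneous] in auto)
    then show ?case using a(2)[OF m] by (simp add: Mod.component_zero)
  next
    case (add b c)
    then show ?case by (simp add: act_add_right a Vec.component_closed)
  qed
  then show ?thesis using a(1) by (simp add: module_annihilator_def Vec.component_closed)
qed

text \<open>If \<open>a\<close> annihilates the module, the Leibniz rules for the differential of a
  m and for the bracket {b, a m} have only one term left each, namely d(a) m and {b, a} m, and so
  these vanish too.\<close>

lemma annihilator_dg_poisson_ideal: "dg_poisson_ideal (module_annihilator A M) A"
proof -
  let ?J = "module_annihilator A M"
  have J: "?J \<subseteq> carrier A" "\<And>a m. \<lbrakk>a \<in> ?J; m \<in> carrier M\<rbrakk> \<Longrightarrow> a \<odot>\<^bsub>M\<^esub> m = \<zero>\<^bsub>M\<^esub>"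
    by (auto simp: module_annihilator_def)
  have add: "a \<oplus>\<^bsub>A\<^esub> b \<in> ?J" if "a \<in> ?J" "b \<in> ?J" for a b
    using that by (auto simp: module_annihilator_def act_add_left)
  have homogeneous: "a \<in> ?J" if a: "a \<in> carrier A"
    "\<And>i m. m \<in> comp M i \<Longrightarrow> a \<odot>\<^bsub>M\<^esub> m = \<zero>\<^bsub>M\<^esub>" for a
  proof -
    have "a \<odot>\<^bsub>M\<^esub> m = \<zero>\<^bsub>M\<^esub>" if "m \<in> carrier M" for m
      using that
      by (induction rule: Mod.graded_induct)
        (simp_all add: act_add_right a)
    then show ?thesis using a(1) by (simp add: module_annihilator_def)
  qed
  have diff: "differential A a \<in> ?J" if a: "a \<in> ?J" for a
  proof (rule Vec.graded_induct_subset[of a ?J])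
    show "a \<in> carrier A" using J a by auto
    fix i b assume b: "b \<in> comp A i" "b \<in> ?J"
    show "differential A b \<in> ?J"
    proof (rule homogeneous)
      show "differential A b \<in> carrier A" using b J differential_closed by auto
      fix j m assume m: "m \<in> comp M j"
      then have "m \<in> carrier M" by (rule Mod.comp_carrier)
      then show "differential A b \<odot>\<^bsub>M\<^esub> m = \<zero>\<^bsub>M\<^esub>"
        using mdiff_act[OF b(1) m] J(2)[OF b(2)] b J(1) mdiff_closed act_closed
          differential_closed
        by (simp add: mdiff_zero Mod.koszul_zero subset_eq)
    qed
  qed (use a add annihilator_component in \<open>auto simp: differential_add\<close>)
  have neg: "\<ominus>\<^bsub>A\<^esub> a \<in> ?J" if "a \<in> ?J" for a
    using that by (auto simp: module_annihilator_def minus_act)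
  have brac: "bracket A a b \<in> ?J" if a: "a \<in> ?J" and b: "b \<in> carrier A" for a b
  proof (rule Vec.graded_induct_subset[of a ?J])
    show "a \<in> carrier A" using J a by auto
    fix i a assume a: "a \<in> comp A i" "a \<in> ?J"
    then have ac: "a \<in> carrier A" using J by auto
    show "bracket A a b \<in> ?J"
      using b
    proof (induction rule: Vec.graded_induct)
      case b: (homogeneous k b)
      note bc = Vec.comp_carrier[OF b]
      \<comment> \<open>\<open>mbracket_act\<close> produces the annihilating element in the second
        slot; antisymmetry then gives the order required of an ideal.\<close>
      have "bracket A b a \<in> ?J"
      proof (rule homogeneous)
        show "bracket A b a \<in> carrier A" by (rule bracket_closed[OF bc ac])
        fix j m assume m: "m \<in> comp M j"
        then have "m \<in> carrier M" by (rule Mod.comp_carrier)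
        then show "bracket A b a \<odot>\<^bsub>M\<^esub> m = \<zero>\<^bsub>M\<^esub>"
          using mbracket_act[OF b a(1) m] J(2)[OF a(2)] ac bc mbracket_closed act_closed
            bracket_closed
          by (simp add: mbracket_zero act_zero Mod.koszul_zero)
      qed
      then show ?case by (simp add: bracket_antisym[OF a(1) b] koszul_def neg)
    next
      case (add b c)
      then show ?case
        using \<open>\<And>a b. \<lbrakk>a \<in> ?J; b \<in> ?J\<rbrakk> \<Longrightarrow> a \<oplus>\<^bsub>A\<^esub> b \<in> ?J\<close> ac
        by (simp add: bracket_add_right)
    qed
  qed (use a b add annihilator_component in \<open>auto simp: bracket_add_left\<close>)
  have "ideal ?J A"
  proof (rule idealI[OF Alg.ring_axioms])
    have "\<zero>\<^bsub>A\<^esub> \<in> ?J" by (simp add: module_annihilator_def zero_act)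
    then show "subgroup ?J (add_monoid A)"
      by (intro subgroup.intro) (simp_all add: J(1) add neg flip: a_inv_def)
  qed (auto simp: module_annihilator_def act_mult act_closed act_zero)
  then show ?thesis
    using diff brac annihilator_component J(1)
    by (auto simp: dg_poisson_ideal_def dg_ideal_def Vec.homogeneous_subset_iff)
qed

text \<open>Only multiplication by \<open>I\<close> has to kill \<open>w\<close>; nothing is asked
  of brackets with \<open>I\<close>. By maximality the sum of the annihilator and \<open>I\<close>
  is \<open>I\<close> or everything, and in the second case the unit is a sum of two elements that
  kill \<open>w\<close>.\<close>

lemma annihilator_subset_maximal_dg_ideal:
  assumes I: "maximal_dg_ideal I A"
    and w: "w \<in> carrier M" "w \<noteq> \<zero>\<^bsub>M\<^esub>" "\<And>a. a \<in> I \<Longrightarrow> a \<odot>\<^bsub>M\<^esub> w = \<zero>\<^bsub>M\<^esub>"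
  shows "module_annihilator A M \<subseteq> I"
proof -
  let ?J = "module_annihilator A M" and ?S = "module_annihilator A M <+>\<^bsub>A\<^esub> I"
  have J: "dg_ideal ?J A" using annihilator_dg_poisson_ideal by (simp add: dg_poisson_ideal_def)
  have I': "dg_ideal I A" using I by (simp add: maximal_dg_ideal_def)
  interpret J: ideal ?J A using J by (simp add: dg_ideal_def)
  interpret I: ideal I A using I' by (simp add: dg_ideal_def)
  have S: "?S = {a \<oplus>\<^bsub>A\<^esub> b | a b. a \<in> ?J \<and> b \<in> I}"
    by (auto simp: set_add_def')
  have sub: "I \<subseteq> ?S" "?J \<subseteq> ?S"
  proof
    fix a assume "a \<in> I"
    then have "a = \<zero>\<^bsub>A\<^esub> \<oplus>\<^bsub>A\<^esub> a" by simp
    then show "a \<in> ?S" using S \<open>a \<in> I\<close> J.zero_closed by blast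
  next
    show "?J \<subseteq> ?S"
    proof
      fix a assume "a \<in> ?J"
      then have "a = a \<oplus>\<^bsub>A\<^esub> \<zero>\<^bsub>A\<^esub>" by simp
      then show "a \<in> ?S" using S \<open>a \<in> ?J\<close> I.zero_closed by blast
    qed
  qed
  have "?S \<noteq> carrier A"
  proof
    assume "?S = carrier A"
    then have "\<one>\<^bsub>A\<^esub> \<in> ?S" by simp
    then obtain a b where ab: "\<one>\<^bsub>A\<^esub> = a \<oplus>\<^bsub>A\<^esub> b" "a \<in> ?J" "b \<in> I" using S by auto
    have "w = \<one>\<^bsub>A\<^esub> \<odot>\<^bsub>M\<^esub> w" using w(1) act_one by simp
    also have "\<dots> = a \<odot>\<^bsub>M\<^esub> w \<oplus>\<^bsub>M\<^esub> b \<odot>\<^bsub>M\<^esub> w" unfolding ab(1)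
      by (rule act_add_left) (use ab w in auto)
    also have "a \<odot>\<^bsub>M\<^esub> w = \<zero>\<^bsub>M\<^esub>" using ab(2) w(1) unfolding module_annihilator_def by blast
    also have "b \<odot>\<^bsub>M\<^esub> w = \<zero>\<^bsub>M\<^esub>" by (rule w(3)[OF ab(3)])
    also have "\<zero>\<^bsub>M\<^esub> \<oplus>\<^bsub>M\<^esub> \<zero>\<^bsub>M\<^esub> = \<zero>\<^bsub>M\<^esub>" by simp
    finally show False using w(2) by simp
  qed
  then have "?S = I"
    using I dg_ideal_add[OF J I'] sub(1) by (auto simp: maximal_dg_ideal_def)
  then show ?thesis using sub(2) by simp
qed

end

section \<open>The right differential\<close>

text \<open>$\delta(a) = (-1)^{|a|+1} d(a)$ for homogeneous \<open>a\<close>.\<close>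

definition right_differential :: "('k, 'a, 'z) dg_scheme \<Rightarrow> 'a \<Rightarrow> 'a" where
  "right_differential A a =
     (\<Oplus>\<^bsub>A\<^esub>i\<in>{i. component A i a \<noteq> \<zero>\<^bsub>A\<^esub>}. koszul A (i + 1) (differential A (component A i a)))"

text \<open>Sorting a sum can leave a term and its negative apart; these rules cancel across the
  gap.\<close>

lemma (in abelian_group) add_conjugate:
  assumes "x \<in> carrier G" "y \<in> carrier G"
  shows "y \<oplus> (x \<oplus> \<ominus> y) = x" "\<ominus> y \<oplus> (x \<oplus> y) = x"
  using assms by (simp_all add: a_comm[of x] r_neg2 r_neg1)

lemma (in abelian_group) add_conjugate':
  assumes "x \<in> carrier G" "y \<in> carrier G" "z \<in> carrier G"
  shows "y \<oplus> (x \<oplus> (z \<oplus> \<ominus> y)) = x \<oplus> z" "y \<oplus> (x \<oplus> (\<ominus> y \<oplus> z)) = x \<oplus> z"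
  using assms add_conjugate(1)[of "x \<oplus> z" y] by (simp_all add: a_assoc a_comm[of "\<ominus> y" z])

text \<open>The sign identities are needed at an arbitrary \<open>c\<close>, the point at which a
  functional is evaluated, while their signs are computed for homogeneous \<open>c\<close>. Only the
  addition of \<open>H\<close> enters, so the rule serves for values in \<open>A\<close> and in
  \<open>K\<close>.\<close>

lemma additive_eqI:
  assumes "graded_group M" "a \<in> carrier M"
    and "\<And>a b. \<lbrakk>a \<in> carrier M; b \<in> carrier M\<rbrakk> \<Longrightarrow> T (a \<oplus>\<^bsub>M\<^esub> b) = T a \<oplus>\<^bsub>H\<^esub> T b"
    and "\<And>a b. \<lbrakk>a \<in> carrier M; b \<in> carrier M\<rbrakk> \<Longrightarrow> T' (a \<oplus>\<^bsub>M\<^esub> b) = T' a \<oplus>\<^bsub>H\<^esub> T' b"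
    and "\<And>i a. a \<in> comp M i \<Longrightarrow> T a = T' a"
  shows "T a = T' a"
proof -
  interpret graded_group M by fact
  show ?thesis using assms(2) by (induction rule: graded_induct) (simp_all add: assms(3-5))
qed

context dg_poisson_algebra
begin

lemma component_smult:
  assumes "c \<in> carrier K" "a \<in> carrier A"
  shows "component A i (c \<odot>\<^bsub>A\<^esub> a) = c \<odot>\<^bsub>A\<^esub> component A i a"
  using component_additive[OF Vec.graded_group_axioms Vec.graded_group_axioms,
      of "\<lambda>a. c \<odot>\<^bsub>A\<^esub> a" 0 a i] assms by (auto simp: Vec.smult_r_distr smult_comp)

lemma differential_zero: "differential A \<zero>\<^bsub>A\<^esub> = \<zero>\<^bsub>A\<^esub>"
  by (rule additive_zero[of A A "differential A"])
    (use Vec.abelian_group_axioms differential_closed differential_add in auto)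

lemma differential_minus: "a \<in> carrier A \<Longrightarrow> differential A (\<ominus>\<^bsub>A\<^esub> a) = \<ominus>\<^bsub>A\<^esub> differential A a"
  by (rule additive_minus[of A A "differential A"])
    (use Vec.abelian_group_axioms differential_closed differential_add in auto)

lemma bracket_minus_left:
  "\<lbrakk>a \<in> carrier A; b \<in> carrier A\<rbrakk> \<Longrightarrow> bracket A (\<ominus>\<^bsub>A\<^esub> a) b = \<ominus>\<^bsub>A\<^esub> bracket A a b"
  by (rule additive_minus[of A A "\<lambda>a. bracket A a b"])
    (use Vec.abelian_group_axioms bracket_closed bracket_add_left in auto)

lemma bracket_minus_right:
  "\<lbrakk>a \<in> carrier A; b \<in> carrier A\<rbrakk> \<Longrightarrow> bracket A a (\<ominus>\<^bsub>A\<^esub> b) = \<ominus>\<^bsub>A\<^esub> bracket A a b"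
  by (rule additive_minus[of A A "bracket A a"])
    (use Vec.abelian_group_axioms bracket_closed bracket_add_right in auto)

text \<open>The supports of two elements and of their sum differ; additivity compares the three sums
  over one common index set.\<close>

lemma right_differential_eq:
  assumes "a \<in> carrier A" "finite S" "{i. component A i a \<noteq> \<zero>\<^bsub>A\<^esub>} \<subseteq> S"
  shows "right_differential A a = (\<Oplus>\<^bsub>A\<^esub>i\<in>S. koszul A (i + 1) (differential A (component A i a)))"
  unfolding right_differential_def
  by (rule Vec.add.finprod_mono_neutral_cong_left)
    (use assms in \<open>auto simp: differential_zero Vec.koszul_zero
      intro!: Vec.koszul_closed differential_closed Vec.component_closed\<close>)

lemma right_differential_closed: "a \<in> carrier A \<Longrightarrow> right_differential A a \<in> carrier A"
  unfolding right_differential_def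
  by (intro Vec.finsum_closed) (auto intro: Vec.koszul_closed differential_closed Vec.component_closed)

lemma right_differential_homogeneous:
  assumes "a \<in> comp A i"
  shows "right_differential A a = koszul A (i + 1) (differential A a)"
proof -
  note a = Vec.comp_carrier[OF assms]
  have "right_differential A a = (\<Oplus>\<^bsub>A\<^esub>j\<in>{i}. koszul A (j + 1) (differential A (component A j a)))"
    by (rule right_differential_eq[OF a])
      (use Vec.component_homogeneous[OF assms] in \<open>auto split: if_splits\<close>)
  also have "\<dots> = koszul A (i + 1) (differential A a)"
    using Vec.component_homogeneous[OF assms, of i] a
    by (simp add: Vec.koszul_closed differential_closed)
  finally show ?thesis .
qed

lemma right_differential_add:
  assumes "a \<in> carrier A" "b \<in> carrier A"
  shows "right_differential A (a \<oplus>\<^bsub>A\<^esub> b) = right_differential A a \<oplus>\<^bsub>A\<^esub> right_differential A b"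
proof -
  let ?S = "{i. component A i a \<noteq> \<zero>\<^bsub>A\<^esub>} \<union> {i. component A i b \<noteq> \<zero>\<^bsub>A\<^esub>}"
  have S: "finite ?S" using assms Vec.finite_component by simp
  have ab: "{i. component A i (a \<oplus>\<^bsub>A\<^esub> b) \<noteq> \<zero>\<^bsub>A\<^esub>} \<subseteq> ?S"
    using assms by (auto simp: Vec.component_add)
  have car: "koszul A (i + 1) (differential A (component A i c)) \<in> carrier A"
    if "c \<in> carrier A" for c i
    using that by (intro Vec.koszul_closed differential_closed Vec.component_closed)
  have eq: "koszul A (i + 1) (differential A (component A i (a \<oplus>\<^bsub>A\<^esub> b))) =
      koszul A (i + 1) (differential A (component A i a))
      \<oplus>\<^bsub>A\<^esub> koszul A (i + 1) (differential A (component A i b))" for i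
    using assms
    by (simp add: Vec.component_add Vec.component_closed differential_add differential_closed
        Vec.koszul_add)
  show ?thesis
    using assms right_differential_eq[OF _ S ab] right_differential_eq[OF assms(1) S]
      right_differential_eq[OF assms(2) S] car
    by (simp add: eq Vec.finsum_addf Pi_def)
qed

lemma koszul_smult:
  "\<lbrakk>c \<in> carrier K; a \<in> carrier A\<rbrakk> \<Longrightarrow> koszul A k (c \<odot>\<^bsub>A\<^esub> a) = c \<odot>\<^bsub>A\<^esub> koszul A k a"
  by (simp add: koszul_def Vec.smult_r_minus)

lemma right_differential_smult:
  assumes "c \<in> carrier K" "a \<in> carrier A"
  shows "right_differential A (c \<odot>\<^bsub>A\<^esub> a) = c \<odot>\<^bsub>A\<^esub> right_differential A a"
  using assms(2)
proof (induction rule: Vec.graded_induct)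
  case (homogeneous i b)
  then show ?case
    using assms(1) Vec.comp_carrier[OF homogeneous] right_differential_homogeneous[OF smult_comp]
    by (simp add: right_differential_homogeneous koszul_smult differential_smult differential_closed)
next
  case (add b d)
  then show ?case
    using assms(1)
    by (simp add: Vec.smult_r_distr right_differential_add right_differential_closed)
qed

lemma right_differential_comp: "a \<in> comp A i \<Longrightarrow> right_differential A a \<in> comp A (i + 1)"
  by (simp add: right_differential_homogeneous Vec.koszul_comp differential_comp)

lemma right_differential_dg_ideal:
  assumes "dg_ideal I A" "a \<in> I"
  shows "right_differential A a \<in> I"
proof -
  interpret ideal I A using assms(1) by (simp add: dg_ideal_def)
  have I: "I \<subseteq> carrier A" "\<And>i. component A i a \<in> I" "\<And>a. a \<in> I \<Longrightarrow> differential A a \<in> I"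
    using assms Vec.homogeneous_subset_iff by (auto simp: dg_ideal_def)
  have "a \<in> carrier A" using I assms(2) by auto
  then show ?thesis
    by (rule Vec.graded_induct_subset[OF _ I(2)])
      (use I in \<open>auto simp: right_differential_homogeneous right_differential_add koszul_def\<close>)
qed

lemma right_differential_square:
  "a \<in> carrier A \<Longrightarrow> right_differential A (right_differential A a) = \<zero>\<^bsub>A\<^esub>"
proof (induction rule: Vec.graded_induct)
  case (homogeneous i b)
  note b = Vec.comp_carrier[OF homogeneous]
  show ?case
    using right_differential_homogeneous[OF right_differential_comp[OF homogeneous]]
      right_differential_homogeneous[OF homogeneous] b
    by (simp add: koszul_def differential_minus differential_closed differential_square)
next
  case (add b c)
  then show ?case by (simp add: right_differential_add right_differential_closed)
qed

text \<open>Unfolding \<open>koszul\<close> turns a sign identity into cases on parities; in each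
  case minus signs move outward and opposite summands cancel.\<close>

lemmas sign_simps = koszul_def Alg.l_minus Alg.r_minus Vec.minus_add bracket_minus_left
  bracket_minus_right differential_minus Alg.l_distr Alg.r_distr
  bracket_add_left bracket_add_right Vec.r_neg Vec.r_neg2 Vec.add_conjugate Vec.add_conjugate'

lemmas additive_simps = right_differential_add Alg.l_distr Alg.r_distr bracket_add_left
  bracket_add_right Vec.koszul_add right_differential_closed bracket_closed Vec.koszul_closed
  differential_closed

text \<open>This identity fixes the sign in \<delta>. Multiplying d(c a) = d(c) a + (-1)^|c| c d(a)
  by (-1)^(|c|+1) gives (-1)^|a| \<delta>(c a) = \<delta>(c) a - c d(a). Without the extra 1 in the
  exponent, c d(a) would end up with the wrong sign. Under a functional this becomes
  \<open>mdiff_act\<close>.\<close>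

lemma right_differential_mult:
  assumes "a \<in> comp A i" "c \<in> carrier A"
  shows "right_differential A c \<otimes>\<^bsub>A\<^esub> a =
    c \<otimes>\<^bsub>A\<^esub> differential A a \<oplus>\<^bsub>A\<^esub> koszul A i (right_differential A (c \<otimes>\<^bsub>A\<^esub> a))"
  using Vec.graded_group_axioms assms(2)
proof (rule additive_eqI[where H = A])
  note a = Vec.comp_carrier[OF assms(1)]
  fix k c assume c: "c \<in> comp A k"
  note car = Vec.comp_carrier[OF c] a
  then have d: "differential A c \<in> carrier A" "differential A a \<in> carrier A"
    by (auto intro: differential_closed)
  have "right_differential A (c \<otimes>\<^bsub>A\<^esub> a) = koszul A (k + i + 1)
      (differential A c \<otimes>\<^bsub>A\<^esub> a \<oplus>\<^bsub>A\<^esub> koszul A k (c \<otimes>\<^bsub>A\<^esub> differential A a))"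
    using right_differential_homogeneous[OF mult_comp[OF c assms(1)]]
      differential_mult[OF c assms(1)] by simp
  then show "right_differential A c \<otimes>\<^bsub>A\<^esub> a =
    c \<otimes>\<^bsub>A\<^esub> differential A a \<oplus>\<^bsub>A\<^esub> koszul A i (right_differential A (c \<otimes>\<^bsub>A\<^esub> a))"
    using car d right_differential_homogeneous[OF c]
    by (simp add: sign_simps Vec.a_ac)
qed (use Vec.comp_carrier[OF assms(1)] in \<open>simp_all add: additive_simps Vec.a_ac\<close>)

text \<open>The same computation with the bracket in place of the product; it becomes
  \<open>mdiff_mbracket\<close>.\<close>

lemma right_differential_bracket:
  assumes "a \<in> comp A i" "c \<in> carrier A"
  shows "bracket A (right_differential A c) a =
    bracket A c (differential A a) \<oplus>\<^bsub>A\<^esub> koszul A i (right_differential A (bracket A c a))"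
  using Vec.graded_group_axioms assms(2)
proof (rule additive_eqI[where H = A])
  note a = Vec.comp_carrier[OF assms(1)]
  fix k c assume c: "c \<in> comp A k"
  note car = Vec.comp_carrier[OF c] a
  then have d: "differential A c \<in> carrier A" "differential A a \<in> carrier A"
    by (auto intro: differential_closed)
  have "right_differential A (bracket A c a) = koszul A (k + i + 1)
      (bracket A (differential A c) a \<oplus>\<^bsub>A\<^esub> koszul A k (bracket A c (differential A a)))"
    using right_differential_homogeneous[OF bracket_comp[OF c assms(1)]]
      differential_bracket[OF c assms(1)] by simp
  then show "bracket A (right_differential A c) a =
    bracket A c (differential A a) \<oplus>\<^bsub>A\<^esub> koszul A i (right_differential A (bracket A c a))"
    using car d right_differential_homogeneous[OF c]
    by (simp add: sign_simps Vec.a_ac bracket_closed)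
qed (use Vec.comp_carrier[OF assms(1)] in \<open>simp_all add: additive_simps Vec.a_ac\<close>)

text \<open>Antisymmetry applied to both sides of \<open>bracket_leibniz\<close>. The rule in the
  first slot is the one needed, since elements act on functionals through the second.\<close>

lemma bracket_mult_left:
  assumes "a \<in> comp A i" "b \<in> comp A j" "c \<in> comp A k"
  shows "bracket A (c \<otimes>\<^bsub>A\<^esub> b) a =
    c \<otimes>\<^bsub>A\<^esub> bracket A b a \<oplus>\<^bsub>A\<^esub> koszul A (i * j) (bracket A c a \<otimes>\<^bsub>A\<^esub> b)"
  using assms[THEN Vec.comp_carrier]
  unfolding bracket_antisym[OF mult_comp[OF assms(3,2)] assms(1)] bracket_leibniz[OF assms(1,3,2)]
    bracket_antisym[OF assms(2,1)] bracket_antisym[OF assms(3,1)]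
  by (simp add: sign_simps Vec.a_ac bracket_closed)

text \<open>This is \<open>mbracket_act\<close> for functionals, evaluated at \<open>c\<close>: the
  outermost operation acts on \<open>c\<close> first. On expanding the last bracket, the terms with
  \<open>c\<close> as outer factor cancel by antisymmetry.\<close>

lemma right_bracket_act:
  assumes "a \<in> comp A i" "b \<in> comp A j" "c \<in> carrier A"
  shows "bracket A c a \<otimes>\<^bsub>A\<^esub> b =
    c \<otimes>\<^bsub>A\<^esub> bracket A a b \<oplus>\<^bsub>A\<^esub> koszul A (i * j) (bracket A (c \<otimes>\<^bsub>A\<^esub> b) a)"
  using Vec.graded_group_axioms assms(3)
proof (rule additive_eqI[where H = A])
  fix k c assume c: "c \<in> comp A k"
  show "bracket A c a \<otimes>\<^bsub>A\<^esub> b =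
    c \<otimes>\<^bsub>A\<^esub> bracket A a b \<oplus>\<^bsub>A\<^esub> koszul A (i * j) (bracket A (c \<otimes>\<^bsub>A\<^esub> b) a)"
    using assms(1,2)[THEN Vec.comp_carrier] Vec.comp_carrier[OF c]
    unfolding bracket_mult_left[OF assms(1,2) c] bracket_antisym[OF assms(2,1)]
    by (simp add: sign_simps Vec.a_ac bracket_closed)
qed (use assms(1,2)[THEN Vec.comp_carrier] in \<open>simp_all add: additive_simps Vec.a_ac\<close>)

text \<open>Becomes \<open>mbracket_mult\<close>. The terms with \<open>c\<close> as outer factor
  cancel again, and graded commutativity reorders the product of \<open>a\<close> and {c,
  b}.\<close>

lemma right_bracket_mult:
  assumes "a \<in> comp A i" "b \<in> comp A j" "c \<in> carrier A"
  shows "bracket A c (a \<otimes>\<^bsub>A\<^esub> b) =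
    bracket A (c \<otimes>\<^bsub>A\<^esub> a) b \<oplus>\<^bsub>A\<^esub> koszul A (i * j) (bracket A (c \<otimes>\<^bsub>A\<^esub> b) a)"
  using Vec.graded_group_axioms assms(3)
proof (rule additive_eqI[where H = A])
  fix k c assume c: "c \<in> comp A k"
  show "bracket A c (a \<otimes>\<^bsub>A\<^esub> b) =
    bracket A (c \<otimes>\<^bsub>A\<^esub> a) b \<oplus>\<^bsub>A\<^esub> koszul A (i * j) (bracket A (c \<otimes>\<^bsub>A\<^esub> b) a)"
    using assms(1,2)[THEN Vec.comp_carrier] Vec.comp_carrier[OF c]
    unfolding bracket_mult_left[OF assms(1,2) c] bracket_mult_left[OF assms(2,1) c]
      bracket_leibniz[OF c assms(1,2)] bracket_antisym[OF assms(2,1)]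
      graded_commutative[OF assms(1) bracket_comp[OF c assms(2)]]
    by (simp add: sign_simps Vec.a_ac bracket_closed)
qed (use assms(1,2)[THEN Vec.comp_carrier] in \<open>simp_all add: additive_simps Vec.a_ac\<close>)

text \<open>The Jacobi identity for c, a, b with one nested bracket turned around by antisymmetry;
  it becomes \<open>mbracket_jacobi\<close>.\<close>

lemma right_bracket_jacobi:
  assumes "a \<in> comp A i" "b \<in> comp A j" "c \<in> carrier A"
  shows "bracket A (bracket A c a) b =
    bracket A c (bracket A a b) \<oplus>\<^bsub>A\<^esub> koszul A (i * j) (bracket A (bracket A c b) a)"
  using Vec.graded_group_axioms assms(3)
proof (rule additive_eqI[where H = A])
  fix k c assume c: "c \<in> comp A k"
  show "bracket A (bracket A c a) b =
    bracket A c (bracket A a b) \<oplus>\<^bsub>A\<^esub> koszul A (i * j) (bracket A (bracket A c b) a)"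
    using assms(1,2)[THEN Vec.comp_carrier] Vec.comp_carrier[OF c]
    unfolding bracket_jacobi[OF c assms(1,2)] bracket_antisym[OF assms(1) bracket_comp[OF c assms(2)]]
    by (simp add: sign_simps Vec.a_ac bracket_closed)
qed (use assms(1,2)[THEN Vec.comp_carrier] in \<open>simp_all add: additive_simps Vec.a_ac\<close>)

end

section \<open>The graded dual\<close>

text \<open>The value zero off the carrier keeps functionals in a normal form, so that functionals
  agreeing on \<open>A\<close> are equal as functions.\<close>

definition pullback ::
    "('k, 'c) ring_scheme \<Rightarrow> ('s, 'a, 'z) module_scheme \<Rightarrow> ('a \<Rightarrow> 'a) \<Rightarrow> ('a \<Rightarrow> 'k) \<Rightarrow> 'a \<Rightarrow> 'k" where
  "pullback K A T f = (\<lambda>b. if b \<in> carrier A then f (T b) else \<zero>\<^bsub>K\<^esub>)"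

text \<open>The graded dual of \<open>A\<close> modulo \<open>P\<close>, with functionals extended by zero outside the carrier.\<close>

definition graded_dual ::
    "('k, 'c) ring_scheme \<Rightarrow> ('k, 'a, 'z) graded_scheme \<Rightarrow> 'a set \<Rightarrow> ('a \<Rightarrow> 'k) set" where
  "graded_dual K A P =
     {f. (\<forall>a. f a \<in> carrier K) \<and> (\<forall>a. a \<notin> carrier A \<longrightarrow> f a = \<zero>\<^bsub>K\<^esub>) \<and>
         (\<forall>a\<in>carrier A. \<forall>b\<in>carrier A. f (a \<oplus>\<^bsub>A\<^esub> b) = f a \<oplus>\<^bsub>K\<^esub> f b) \<and>
         (\<forall>c\<in>carrier K. \<forall>a\<in>carrier A. f (c \<odot>\<^bsub>A\<^esub> a) = c \<otimes>\<^bsub>K\<^esub> f a) \<and>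
         (\<forall>a\<in>P. f a = \<zero>\<^bsub>K\<^esub>) \<and> finite {i. \<exists>a\<in>comp A i. f a \<noteq> \<zero>\<^bsub>K\<^esub>}}"

text \<open>
  The algebra acts on functionals through its right multiplications, right brackets and
  right differential; for a left module structure this needs no further signs.
\<close>

definition dual_module ::
    "('k, 'c) ring_scheme \<Rightarrow> ('k, 'a, 'z) dg_poisson_scheme \<Rightarrow> ('a \<Rightarrow> 'k) set
      \<Rightarrow> ('a, 'a \<Rightarrow> 'k) dg_poisson_mod" where
  "dual_module K A N =
     \<lparr>carrier = N, mult = undefined, one = undefined,
      zero = (\<lambda>b. \<zero>\<^bsub>K\<^esub>), add = (\<lambda>f g b. f b \<oplus>\<^bsub>K\<^esub> g b),
      smult = (\<lambda>a. pullback K A (\<lambda>b. b \<otimes>\<^bsub>A\<^esub> a)),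
      comp = (\<lambda>i. {f \<in> N. \<forall>j. j \<noteq> - i \<longrightarrow> (\<forall>b\<in>comp A j. f b = \<zero>\<^bsub>K\<^esub>)}),
      differential = pullback K A (right_differential A),
      mbracket = (\<lambda>a. pullback K A (\<lambda>b. bracket A b a))\<rparr>"

text \<open>A condition on sets of functionals instead of a module predicate, so that the module
  generated by a functional is an intersection and its elements need no description. Scalars and
  negatives are covered by the action of multiples of the unit.\<close>

definition dual_closed ::
    "('k, 'c) ring_scheme \<Rightarrow> ('k, 'a, 'z) dg_poisson_scheme \<Rightarrow> 'a set \<Rightarrow> ('a \<Rightarrow> 'k) set \<Rightarrow> bool" where
  "dual_closed K A P N \<longleftrightarrow>
     N \<subseteq> graded_dual K A P \<and> (\<lambda>b. \<zero>\<^bsub>K\<^esub>) \<in> N \<and>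
     (\<forall>f\<in>N. \<forall>g\<in>N. (\<lambda>b. f b \<oplus>\<^bsub>K\<^esub> g b) \<in> N) \<and>
     (\<forall>f\<in>N. pullback K A (right_differential A) f \<in> N \<and>
        (\<forall>i. pullback K A (component A i) f \<in> N) \<and>
        (\<forall>a\<in>carrier A. pullback K A (\<lambda>b. b \<otimes>\<^bsub>A\<^esub> a) f \<in> N \<and>
                        pullback K A (\<lambda>b. bracket A b a) f \<in> N))"

lemma dual_module_simps [simp]:
  "carrier (dual_module K A N) = N"
  "\<zero>\<^bsub>dual_module K A N\<^esub> = (\<lambda>b. \<zero>\<^bsub>K\<^esub>)"
  "f \<oplus>\<^bsub>dual_module K A N\<^esub> g = (\<lambda>b. f b \<oplus>\<^bsub>K\<^esub> g b)"
  "a \<odot>\<^bsub>dual_module K A N\<^esub> f = pullback K A (\<lambda>b. b \<otimes>\<^bsub>A\<^esub> a) f"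
  "comp (dual_module K A N) i = {f \<in> N. \<forall>j. j \<noteq> - i \<longrightarrow> (\<forall>b\<in>comp A j. f b = \<zero>\<^bsub>K\<^esub>)}"
  "differential (dual_module K A N) = pullback K A (right_differential A)"
  "mbracket (dual_module K A N) a f = pullback K A (\<lambda>b. bracket A b a) f"
  by (simp_all add: dual_module_def)

context dg_poisson_algebra
begin

lemma graded_dualD:
  assumes "f \<in> graded_dual K A P"
  shows "f a \<in> carrier K" "a \<notin> carrier A \<Longrightarrow> f a = \<zero>\<^bsub>K\<^esub>"
    "\<lbrakk>a \<in> carrier A; b \<in> carrier A\<rbrakk> \<Longrightarrow> f (a \<oplus>\<^bsub>A\<^esub> b) = f a \<oplus>\<^bsub>K\<^esub> f b"
    "\<lbrakk>c \<in> carrier K; a \<in> carrier A\<rbrakk> \<Longrightarrow> f (c \<odot>\<^bsub>A\<^esub> a) = c \<otimes>\<^bsub>K\<^esub> f a"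
    "a \<in> P \<Longrightarrow> f a = \<zero>\<^bsub>K\<^esub>"
    "finite {i. \<exists>a\<in>comp A i. f a \<noteq> \<zero>\<^bsub>K\<^esub>}"
  using assms by (auto simp: graded_dual_def)

lemma graded_dual_zero: "(\<lambda>b. \<zero>\<^bsub>K\<^esub>) \<in> graded_dual K A P"
  by (simp add: graded_dual_def)

lemma graded_dual_add:
  assumes "f \<in> graded_dual K A P" "g \<in> graded_dual K A P"
  shows "(\<lambda>b. f b \<oplus>\<^bsub>K\<^esub> g b) \<in> graded_dual K A P"
proof -
  note f = graded_dualD[OF assms(1)] and g = graded_dualD[OF assms(2)]
  have "{i. \<exists>a\<in>comp A i. f a \<oplus>\<^bsub>K\<^esub> g a \<noteq> \<zero>\<^bsub>K\<^esub>} \<subseteq>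
      {i. \<exists>a\<in>comp A i. f a \<noteq> \<zero>\<^bsub>K\<^esub>} \<union> {i. \<exists>a\<in>comp A i. g a \<noteq> \<zero>\<^bsub>K\<^esub>}"
  proof
    fix i assume "i \<in> {i. \<exists>a\<in>comp A i. f a \<oplus>\<^bsub>K\<^esub> g a \<noteq> \<zero>\<^bsub>K\<^esub>}"
    then obtain a where "a \<in> comp A i" "f a \<oplus>\<^bsub>K\<^esub> g a \<noteq> \<zero>\<^bsub>K\<^esub>" by blast
    moreover from this have "f a \<noteq> \<zero>\<^bsub>K\<^esub> \<or> g a \<noteq> \<zero>\<^bsub>K\<^esub>" by auto
    ultimately show "i \<in> {i. \<exists>a\<in>comp A i. f a \<noteq> \<zero>\<^bsub>K\<^esub>} \<union> {i. \<exists>a\<in>comp A i. g a \<noteq> \<zero>\<^bsub>K\<^esub>}"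
      by blast
  qed
  then have "finite {i. \<exists>a\<in>comp A i. f a \<oplus>\<^bsub>K\<^esub> g a \<noteq> \<zero>\<^bsub>K\<^esub>}"
    using f(6) g(6) finite_subset by blast
  then show ?thesis
    using f(1-5) g(1-5) by (simp add: graded_dual_def a_ac r_distr)
qed

text \<open>Homogeneity of \<open>T\<close> matters for the finiteness condition: composing with a
  map of degree \<open>k\<close> moves the set of degrees where \<open>f\<close> is nonzero by
  \<open>- k\<close>.\<close>

lemma pullback_graded_dual:
  assumes "f \<in> graded_dual K A P"
    and "\<And>a. a \<in> carrier A \<Longrightarrow> T a \<in> carrier A"
    and "\<And>a b. \<lbrakk>a \<in> carrier A; b \<in> carrier A\<rbrakk> \<Longrightarrow> T (a \<oplus>\<^bsub>A\<^esub> b) = T a \<oplus>\<^bsub>A\<^esub> T b"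
    and "\<And>c a. \<lbrakk>c \<in> carrier K; a \<in> carrier A\<rbrakk> \<Longrightarrow> T (c \<odot>\<^bsub>A\<^esub> a) = c \<odot>\<^bsub>A\<^esub> T a"
    and "\<And>a. a \<in> P \<Longrightarrow> T a \<in> P"
    and "\<And>i a. a \<in> comp A i \<Longrightarrow> T a \<in> comp A (i + k)"
  shows "pullback K A T f \<in> graded_dual K A P"
proof -
  note f = graded_dualD[OF assms(1)]
  have "{i. \<exists>a\<in>comp A i. pullback K A T f a \<noteq> \<zero>\<^bsub>K\<^esub>} \<subseteq>
      (\<lambda>i. i - k) ` {i. \<exists>a\<in>comp A i. f a \<noteq> \<zero>\<^bsub>K\<^esub>}" (is "?L \<subseteq> ?R")
  proof
    fix i assume "i \<in> ?L"
    then obtain a where "a \<in> comp A i" "f (T a) \<noteq> \<zero>\<^bsub>K\<^esub>"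
      by (auto simp: pullback_def split: if_splits)
    then have "i + k \<in> {i. \<exists>a\<in>comp A i. f a \<noteq> \<zero>\<^bsub>K\<^esub>}" using assms(6) by blast
    then show "i \<in> ?R" by (intro image_eqI[of _ _ "i + k"]) auto
  qed
  then have "finite ?L" using f(6) finite_surj by blast
  moreover have "pullback K A T f a = \<zero>\<^bsub>K\<^esub>" if "a \<in> P" for a
    using f(5) assms(5)[OF that] by (simp add: pullback_def)
  ultimately show ?thesis
    using f(1-4) assms(2-4) by (simp add: graded_dual_def) (simp add: pullback_def)
qed

lemma graded_dual_closed:
  assumes P: "dg_poisson_ideal P A"
  shows "dual_closed K A P (graded_dual K A P)"
proof -
  let ?D = "graded_dual K A P"
  have "dg_ideal P A" using P by (simp add: dg_poisson_ideal_def)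
  interpret ideal P A using P by (simp add: dg_poisson_ideal_def dg_ideal_def)
  have P': "P \<subseteq> carrier A" "\<And>i a. a \<in> P \<Longrightarrow> component A i a \<in> P"
      "\<And>a b. \<lbrakk>a \<in> P; b \<in> carrier A\<rbrakk> \<Longrightarrow> bracket A a b \<in> P"
    using P Vec.homogeneous_subset_iff by (auto simp: dg_poisson_ideal_def dg_ideal_def)
  have diff: "pullback K A (right_differential A) f \<in> ?D" if "f \<in> ?D" for f
    using that
    by (rule pullback_graded_dual[where k = 1])
      (auto simp: right_differential_closed right_differential_add right_differential_smult
        right_differential_comp right_differential_dg_ideal[OF \<open>dg_ideal P A\<close>])
  have cmp: "pullback K A (component A i) f \<in> ?D" if "f \<in> ?D" for f i
    using that
    by (rule pullback_graded_dual[where k = 0])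
      (auto simp: Vec.component_closed Vec.component_add component_smult P' Vec.component_homogeneous
        Vec.comp_zero)
  \<comment> \<open>Multiplication by a non-homogeneous element need not be a homogeneous map, so
    \<open>pullback_graded_dual\<close> covers homogeneous elements only; the others are reached by
    adding functionals.\<close>
  have pullback_add: "pullback K A (\<lambda>b. T b \<oplus>\<^bsub>A\<^esub> U b) f \<in> ?D"
    if "f \<in> ?D" "pullback K A T f \<in> ?D" "pullback K A U f \<in> ?D"
      "\<And>b. b \<in> carrier A \<Longrightarrow> T b \<in> carrier A" "\<And>b. b \<in> carrier A \<Longrightarrow> U b \<in> carrier A" for f T U
  proof -
    have "pullback K A (\<lambda>b. T b \<oplus>\<^bsub>A\<^esub> U b) f = (\<lambda>b. pullback K A T f b \<oplus>\<^bsub>K\<^esub> pullback K A U f b)"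
      using graded_dualD[OF that(1)] that(4,5) by (auto simp: pullback_def fun_eq_iff)
    then show ?thesis using graded_dual_add[OF that(2,3)] by simp
  qed
  have act: "pullback K A (\<lambda>b. b \<otimes>\<^bsub>A\<^esub> a) f \<in> ?D" if a: "a \<in> carrier A" and f: "f \<in> ?D" for f a
    using a
  proof (induction rule: Vec.graded_induct)
    case (homogeneous i a)
    note a = Vec.comp_carrier[OF homogeneous]
    show ?case
      using f
      by (rule pullback_graded_dual[where k = i])
        (use a homogeneous in \<open>auto simp: Alg.l_distr smult_mult_left mult_comp I_r_closed\<close>)
  next
    case (add a b)
    have "pullback K A (\<lambda>x. x \<otimes>\<^bsub>A\<^esub> (a \<oplus>\<^bsub>A\<^esub> b)) f =
        pullback K A (\<lambda>x. x \<otimes>\<^bsub>A\<^esub> a \<oplus>\<^bsub>A\<^esub> x \<otimes>\<^bsub>A\<^esub> b) f"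
      using add(1,2) by (auto simp: pullback_def fun_eq_iff Alg.r_distr)
    then show ?case
      using pullback_add[OF f add(3,4)] add(1,2) by simp
  qed
  have brac: "pullback K A (\<lambda>b. bracket A b a) f \<in> ?D" if a: "a \<in> carrier A" and f: "f \<in> ?D" for f a
    using a
  proof (induction rule: Vec.graded_induct)
    case (homogeneous i a)
    note a = Vec.comp_carrier[OF homogeneous]
    show ?case
      using f
      by (rule pullback_graded_dual[where k = i])
        (use a homogeneous in \<open>auto simp: bracket_closed bracket_add_left bracket_smult_left
            bracket_comp P'\<close>)
  next
    case (add a b)
    have "pullback K A (\<lambda>x. bracket A x (a \<oplus>\<^bsub>A\<^esub> b)) f =
        pullback K A (\<lambda>x. bracket A x a \<oplus>\<^bsub>A\<^esub> bracket A x b) f"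
      using add(1,2) by (auto simp: pullback_def fun_eq_iff bracket_add_right)
    then show ?case
      using pullback_add[OF f add(3,4)] add(1,2) by (simp add: bracket_closed)
  qed
  show ?thesis
    using diff cmp act brac graded_dual_zero graded_dual_add by (auto simp: dual_closed_def)
qed

section \<open>The DG Poisson module structure on a closed set of functionals\<close>

context
  fixes P N
  assumes N: "dual_closed K A P N"
begin

lemma dual_closedD:
  "f \<in> N \<Longrightarrow> f \<in> graded_dual K A P" "(\<lambda>b. \<zero>\<^bsub>K\<^esub>) \<in> N"
  "\<lbrakk>f \<in> N; g \<in> N\<rbrakk> \<Longrightarrow> (\<lambda>b. f b \<oplus>\<^bsub>K\<^esub> g b) \<in> N"
  "f \<in> N \<Longrightarrow> pullback K A (right_differential A) f \<in> N"
  "f \<in> N \<Longrightarrow> pullback K A (component A i) f \<in> N"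
  "\<lbrakk>a \<in> carrier A; f \<in> N\<rbrakk> \<Longrightarrow> pullback K A (\<lambda>b. b \<otimes>\<^bsub>A\<^esub> a) f \<in> N"
  "\<lbrakk>a \<in> carrier A; f \<in> N\<rbrakk> \<Longrightarrow> pullback K A (\<lambda>b. bracket A b a) f \<in> N"
  using N by (auto simp: dual_closed_def)

lemmas dualD = graded_dualD[OF dual_closedD(1)]

private abbreviation (input) "D \<equiv> dual_module K A N"

lemma dual_zero: "f \<in> N \<Longrightarrow> f \<zero>\<^bsub>A\<^esub> = \<zero>\<^bsub>K\<^esub>"
  by (rule additive_zero[of A K f]) (use Vec.abelian_group_axioms abelian_group_axioms dualD in auto)

lemma dual_minus: "\<lbrakk>f \<in> N; a \<in> carrier A\<rbrakk> \<Longrightarrow> f (\<ominus>\<^bsub>A\<^esub> a) = \<ominus>\<^bsub>K\<^esub> f a"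
  by (rule additive_minus[of A K f]) (use Vec.abelian_group_axioms abelian_group_axioms dualD in auto)

lemma dual_koszul: "\<lbrakk>f \<in> N; a \<in> carrier A\<rbrakk> \<Longrightarrow> f (koszul A k a) = koszul K k (f a)"
  by (simp add: koszul_def dual_minus)

lemma dual_neg_closed: "f \<in> N \<Longrightarrow> (\<lambda>b. \<ominus>\<^bsub>K\<^esub> f b) \<in> N"
proof -
  assume f: "f \<in> N"
  have "pullback K A (\<lambda>b. b \<otimes>\<^bsub>A\<^esub> \<ominus>\<^bsub>A\<^esub> \<one>\<^bsub>A\<^esub>) f = (\<lambda>b. \<ominus>\<^bsub>K\<^esub> f b)"
    using dualD[OF f] dual_minus[OF f] by (auto simp: pullback_def fun_eq_iff Alg.r_minus)
  then show ?thesis using dual_closedD(6)[of "\<ominus>\<^bsub>A\<^esub> \<one>\<^bsub>A\<^esub>" f] f by simp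
qed

lemma dual_abelian_group: "abelian_group D"
proof (rule abelian_groupI)
  fix f assume "f \<in> carrier D"
  then show "\<exists>g\<in>carrier D. g \<oplus>\<^bsub>D\<^esub> f = \<zero>\<^bsub>D\<^esub>"
    using dualD(1) dual_neg_closed by (auto simp: fun_eq_iff l_neg intro!: bexI[of _ "\<lambda>b. \<ominus>\<^bsub>K\<^esub> f b"])
qed (use dual_closedD dualD(1) in \<open>auto simp: a_ac\<close>)

lemma dual_a_inv:
  assumes "f \<in> N"
  shows "\<ominus>\<^bsub>D\<^esub> f = (\<lambda>b. \<ominus>\<^bsub>K\<^esub> f b)"
  by (rule abelian_group.minus_equality[OF dual_abelian_group])
    (use assms dual_neg_closed dualD(1) in \<open>auto simp: l_neg\<close>)

lemma dual_module_koszul: "f \<in> N \<Longrightarrow> koszul D k f = (\<lambda>b. koszul K k (f b))"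
  by (simp add: koszul_def dual_a_inv)

text \<open>A functional of degree \<open>i\<close> lives on the part of \<open>A\<close> of degree
  \<open>- i\<close>, so composing with the projections of \<open>A\<close> gives the projections
  required by \<open>graded_groupI\<close>.\<close>

lemma dual_graded:
  shows "graded_group D" and "f \<in> N \<Longrightarrow> component D i f = pullback K A (component A (- i)) f"
proof -
  interpret D: abelian_group D by (rule dual_abelian_group)
  let ?p = "\<lambda>i. pullback K A (component A (- i))"
  have sub: "additive_subgroup (comp D i) D" for i
  proof (intro additive_subgroup.intro subgroup.intro)
    fix f assume "f \<in> comp D i"
    then show "inv\<^bsub>add_monoid D\<^esub> f \<in> comp D i"
      unfolding a_inv_def[symmetric] by (auto simp: dual_a_inv dual_neg_closed)
  qed (use dual_closedD in auto)
  have pc: "?p i f \<in> comp D i" if "f \<in> carrier D" for i f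
    using that dual_closedD(5) dual_zero Vec.component_homogeneous
    by (auto simp: pullback_def)
  have pa: "?p i (f \<oplus>\<^bsub>D\<^esub> g) = ?p i f \<oplus>\<^bsub>D\<^esub> ?p i g" if "f \<in> carrier D" "g \<in> carrier D" for i f g
    by (auto simp: pullback_def fun_eq_iff)
  have ph: "?p i f = (if i = j then f else \<zero>\<^bsub>D\<^esub>)" if "f \<in> comp D j" for i j f
  proof
    fix b
    have f: "f \<in> N" and vanish: "\<And>l b. \<lbrakk>l \<noteq> - j; b \<in> comp A l\<rbrakk> \<Longrightarrow> f b = \<zero>\<^bsub>K\<^esub>"
      using that by auto
    show "?p i f b = (if i = j then f else \<zero>\<^bsub>D\<^esub>) b"
    proof (cases "b \<in> carrier A")
      case True
      have "f (component A (- i) b) = (if i = j then f b else \<zero>\<^bsub>K\<^esub>)"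
        using Vec.graded_group_axioms True
      proof (rule additive_eqI[where H = K])
        fix l b assume "b \<in> comp A l"
        then show "f (component A (- i) b) = (if i = j then f b else \<zero>\<^bsub>K\<^esub>)"
          using vanish[of l b] dual_zero[OF f] by (auto simp: Vec.component_homogeneous)
      qed (use dualD[OF f] in \<open>auto simp: Vec.component_add Vec.component_closed\<close>)
      then show ?thesis using True by (simp add: pullback_def)
    qed (use dualD[OF f] in \<open>auto simp: pullback_def\<close>)
  qed
  have ev: "(\<Oplus>\<^bsub>D\<^esub>i\<in>S. g i) b = (\<Oplus>\<^bsub>K\<^esub>i\<in>S. g i b)"
    if "finite S" "\<And>i. g i \<in> N" for S :: "int set" and g b
    using that(1)
    by (induction S rule: finite_induct) (use that(2) dualD(1) in \<open>simp_all add: Pi_def\<close>)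
  have ex: "\<exists>S. finite S \<and> (\<forall>i. i \<notin> S \<longrightarrow> ?p i f = \<zero>\<^bsub>D\<^esub>) \<and> f = (\<Oplus>\<^bsub>D\<^esub>i\<in>S. ?p i f)"
    if "f \<in> carrier D" for f
  proof -
    have f: "f \<in> N" using that by simp
    \<comment> \<open>The negatives of the degrees on which \<open>f\<close> is nonzero; their
      number is finite by the definition of \<open>graded_dual\<close>.\<close>
    let ?S = "uminus ` {i. \<exists>a\<in>comp A i. f a \<noteq> \<zero>\<^bsub>K\<^esub>}"
    have S: "finite ?S" using dualD(6)[OF f] by simp
    have out: "f b = \<zero>\<^bsub>K\<^esub>" if "- i \<notin> ?S" "b \<in> comp A i" for i b
      using that by (auto simp: image_iff)
    have sum: "f b = (\<Oplus>\<^bsub>K\<^esub>i\<in>?S. f (component A (- i) b))" if b: "b \<in> carrier A" for b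
      using Vec.graded_group_axioms b
    proof (rule additive_eqI[where H = K])
      fix j b assume b: "b \<in> comp A j"
      \<comment> \<open>On a homogeneous element of degree \<open>j\<close> a single index,
        \<open>- j\<close>, can contribute; if it lies outside the index set, then
        \<open>f b\<close> is zero anyway.\<close>
      have eq: "f (component A (- i) b) = (if - j = i then f b else \<zero>\<^bsub>K\<^esub>)" for i
        using dual_zero[OF f] by (auto simp: Vec.component_homogeneous[OF b])
      show "f b = (\<Oplus>\<^bsub>K\<^esub>i\<in>?S. f (component A (- i) b))"
        unfolding eq
      proof (cases "- j \<in> ?S")
        case True
        then show "f b = (\<Oplus>\<^bsub>K\<^esub>i\<in>?S. if - j = i then f b else \<zero>\<^bsub>K\<^esub>)"
          using finsum_singleton[OF True S, of "\<lambda>_. f b"] dualD(1)[OF f] by simp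
      next
        case False
        have "(\<Oplus>\<^bsub>K\<^esub>i\<in>?S. if - j = i then f b else \<zero>\<^bsub>K\<^esub>) = (\<Oplus>\<^bsub>K\<^esub>i\<in>?S. \<zero>\<^bsub>K\<^esub>)"
          by (rule finsum_cong') (use False in auto)
        then show "f b = (\<Oplus>\<^bsub>K\<^esub>i\<in>?S. if - j = i then f b else \<zero>\<^bsub>K\<^esub>)"
          using out[OF False b] by simp
      qed
    qed (use dualD[OF f] in \<open>auto simp: Vec.component_add Vec.component_closed finsum_addf Pi_def\<close>)
    have "f = (\<Oplus>\<^bsub>D\<^esub>i\<in>?S. ?p i f)"
    proof
      fix b
      show "f b = (\<Oplus>\<^bsub>D\<^esub>i\<in>?S. ?p i f) b"
        using ev[OF S, of "\<lambda>i. ?p i f" b] dual_closedD(5)[OF f] sum dualD(2)[OF f]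
        by (cases "b \<in> carrier A") (simp_all add: pullback_def)
    qed
    moreover have "?p i f = \<zero>\<^bsub>D\<^esub>" if "i \<notin> ?S" for i
      using out[of "- i"] that Vec.component_comp by (auto simp: pullback_def fun_eq_iff)
    ultimately show ?thesis using S by blast
  qed
  show "graded_group D"
    by (rule graded_groupI(1)[of D ?p]) (fact D.abelian_group_axioms sub pc pa ph ex)+
  show "component D i f = ?p i f" if "f \<in> N"
    by (rule graded_groupI(2)[of D ?p])
      (fact D.abelian_group_axioms sub pc pa ph ex | use that in simp)+
qed

lemma dual_base_smult:
  assumes "c \<in> carrier K" "f \<in> N"
  shows "base_smult A D c f = (\<lambda>b. c \<otimes>\<^bsub>K\<^esub> f b)"
  using assms dualD[OF assms(2)] smult_mult_right[of c _ "\<one>\<^bsub>A\<^esub>"]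
  by (auto simp: base_smult_def pullback_def fun_eq_iff)

lemma pullback_apply:
  "pullback K A T f b = (if b \<in> carrier A then f (T b) else \<zero>\<^bsub>K\<^esub>)"
  by (simp add: pullback_def)

lemma pullback_comp:
  assumes "pullback K A T f \<in> N" "f \<in> comp D j" "\<And>k b. b \<in> comp A k \<Longrightarrow> T b \<in> comp A (k + i)"
  shows "pullback K A T f \<in> comp D (i + j)"
proof -
  have "f (T b) = \<zero>\<^bsub>K\<^esub>" if "k \<noteq> - (i + j)" "b \<in> comp A k" for k b
  proof -
    have "k + i \<noteq> - j" using that(1) by simp
    then show ?thesis using assms(2,3) that(2) by auto
  qed
  then show ?thesis using assms(1) by (simp add: pullback_apply)
qed

text \<open>Each module law is an equality of functions: at a point of \<open>A\<close> it is
  \<open>f\<close> applied to one of the right-handed identities for product, bracket and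
  differential, and elsewhere both sides are zero.\<close>

lemma dual_dg_poisson_module: "dg_poisson_module K A D"
proof -
  have koszul_zero: "koszul K k \<zero>\<^bsub>K\<^esub> = \<zero>\<^bsub>K\<^esub>" for k by (simp add: koszul_def)
  note closed = Vec.comp_carrier Vec.koszul_closed right_differential_closed bracket_closed
    differential_closed
  note eval = fun_eq_iff pullback_apply dual_module_koszul dual_base_smult dual_zero dual_koszul
    dualD dual_closedD koszul_zero
  have jacobi: "mbracket D a (mbracket D b f)
            = mbracket D (bracket A a b) f
              \<oplus>\<^bsub>D\<^esub> koszul D (i * j) (mbracket D b (mbracket D a f))"
    if "a \<in> comp A i" "b \<in> comp A j" "f \<in> N" for a b f i j
  proof
    fix c
    show "mbracket D a (mbracket D b f) c
            = (mbracket D (bracket A a b) f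
              \<oplus>\<^bsub>D\<^esub> koszul D (i * j) (mbracket D b (mbracket D a f))) c"
      using that right_bracket_jacobi[OF that(1,2), of c] that(1,2)[THEN Vec.comp_carrier]
      by (cases "c \<in> carrier A") (simp_all add: eval closed)
  qed
  show ?thesis
  proof (intro dg_poisson_module.intro graded_left_module.intro graded_left_module_axioms.intro
      dg_poisson_module_axioms.intro dg_poisson_algebra_axioms graded_algebra_axioms dual_graded)
    fix a i f j assume a: "a \<in> comp A i" and f: "f \<in> comp D j"
    then have "a \<in> carrier A" "f \<in> N" by (auto intro: Vec.comp_carrier)
    then have "pullback K A (\<lambda>b. b \<otimes>\<^bsub>A\<^esub> a) f \<in> comp D (i + j)"
      "pullback K A (\<lambda>b. bracket A b a) f \<in> comp D (i + j)"
      using f a by (auto intro!: pullback_comp dual_closedD mult_comp bracket_comp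
          simp del: dual_module_simps(5))
    then show "a \<odot>\<^bsub>D\<^esub> f \<in> comp D (i + j)" "mbracket D a f \<in> comp D (i + j)"
      by simp_all
  next
    fix f i assume f: "f \<in> comp D i"
    then have "pullback K A (right_differential A) f \<in> comp D (1 + i)"
      by (intro pullback_comp dual_closedD right_differential_comp) auto
    then show "differential D f \<in> comp D (i + 1)"
      by (simp add: add.commute)
  next
    fix a b i j f l assume "a \<in> comp A i" "b \<in> comp A j" "f \<in> comp D l"
    then show "mbracket D a (mbracket D b f)
              = mbracket D (bracket A a b) f
                \<oplus>\<^bsub>D\<^esub> koszul D (i * j) (mbracket D b (mbracket D a f))"
      by (intro jacobi) auto
  qed (auto simp: eval closed mult_comp smult_mult_right Alg.r_distr Alg.m_assoc
      right_differential_square right_differential_smult right_differential_mult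
      right_differential_bracket right_bracket_act right_bracket_mult bracket_add_right
      bracket_smult_right bracket_smult_left)
qed

end

end

section \<open>Separating functionals and the annihilator theorem\<close>

context dg_poisson_algebra
begin

text \<open>Stands in for extending a basis: a subspace maximal among those missing \<open>w\<close>
  is a complement of the line through \<open>w\<close>.\<close>

lemma ex_maximal_subspace:
  assumes L0: "submodule L0 K A" "w \<notin> L0"
  shows "\<exists>L. submodule L K A \<and> L0 \<subseteq> L \<and> w \<notin> L \<and>
    (\<forall>L'. submodule L' K A \<and> L \<subseteq> L' \<and> w \<notin> L' \<longrightarrow> L' = L)"
proof -
  let ?C = "{L. submodule L K A \<and> L0 \<subseteq> L \<and> w \<notin> L}"
  have "\<exists>L\<in>?C. \<forall>L'\<in>?C. L \<subseteq> L' \<longrightarrow> L' = L"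
  proof (rule subset_Zorn_nonempty)
    show "?C \<noteq> {}" using L0 by blast
    fix C assume C: "C \<noteq> {}" "subset.chain ?C C"
    then have sub: "submodule L K A" and L: "L0 \<subseteq> L" "w \<notin> L" if "L \<in> C" for L
      using that by (auto simp: subset.chain_def)
    have "submodule (\<Union>C) K A"
    proof (rule Vec.submoduleI)
      show "\<Union>C \<subseteq> carrier A" using Vec.submoduleE(1)[OF sub] by blast
      have "\<zero>\<^bsub>A\<^esub> \<in> L0"
        using subgroup.one_closed[OF submodule.axioms(1)[OF L0(1)]] by simp
      then show "\<zero>\<^bsub>A\<^esub> \<in> \<Union>C" using C(1) L(1) by blast
      fix a b assume "a \<in> \<Union>C" "b \<in> \<Union>C"
      then obtain X Y where "X \<in> C" "a \<in> X" "Y \<in> C" "b \<in> Y" by blast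
      moreover from this have "X \<subseteq> Y \<or> Y \<subseteq> X" using C(2) by (auto simp: subset_chain_def)
      ultimately obtain L where "L \<in> C" "a \<in> L" "b \<in> L" by blast
      then show "a \<oplus>\<^bsub>A\<^esub> b \<in> \<Union>C" using Vec.submoduleE(5)[OF sub[OF \<open>L \<in> C\<close>]] by blast
    qed (auto intro: Vec.submoduleE(3,4)[OF sub])
    then show "\<Union>C \<in> ?C" using L C(1) by blast
  qed
  then obtain L where L: "L \<in> ?C" "\<forall>L'\<in>?C. L \<subseteq> L' \<longrightarrow> L' = L" ..
  have "L' = L" if "submodule L' K A" "L \<subseteq> L'" "w \<notin> L'" for L'
    using L that by auto
  then show ?thesis using L(1) by blast
qed

text \<open>\<open>\<phi> a\<close> is the coordinate of \<open>a\<close> along the unit, modulo a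
  hyperplane \<open>L\<close> that misses the unit.\<close>

lemma ex_functional:
  assumes I: "dg_ideal I A" "I \<noteq> carrier A"
  shows "\<exists>\<phi>\<in>graded_dual K A I. \<phi> \<one>\<^bsub>A\<^esub> = \<one>\<^bsub>K\<^esub>"
proof -
  interpret I: ideal I A using I(1) by (simp add: dg_ideal_def)
  have IC: "I \<subseteq> carrier A" "\<And>i a. a \<in> I \<Longrightarrow> component A i a \<in> I"
    using I(1) Vec.homogeneous_subset_iff by (auto simp: dg_ideal_def)
  have smI: "c \<odot>\<^bsub>A\<^esub> a \<in> I" if "c \<in> carrier K" "a \<in> I" for c a
  proof -
    have "c \<odot>\<^bsub>A\<^esub> a = (c \<odot>\<^bsub>A\<^esub> \<one>\<^bsub>A\<^esub>) \<otimes>\<^bsub>A\<^esub> a"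
      using smult_mult_left[of c "\<one>\<^bsub>A\<^esub>" a] that IC(1) by auto
    then show ?thesis using that by (simp add: I.I_l_closed)
  qed
  have one: "\<one>\<^bsub>A\<^esub> \<notin> I" using I.one_imp_carrier I(2) by blast
  \<comment> \<open>Contains \<open>I\<close>, which is homogeneous, and every element of a degree
    other than 0; so vanishing here gives both vanishing on \<open>I\<close> and degree 0. The unit
    lies outside, being its own component of degree 0.\<close>
  define L0 where "L0 = {a \<in> carrier A. component A 0 a \<in> I}"
  have comp_minus: "component A 0 (\<ominus>\<^bsub>A\<^esub> a) = \<ominus>\<^bsub>A\<^esub> component A 0 a" if "a \<in> carrier A" for a
    by (rule additive_minus[of A A "component A 0"])
      (use that Vec.abelian_group_axioms Vec.component_closed Vec.component_add in auto)
  have "submodule L0 K A"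
    by (rule Vec.submoduleI)
      (auto simp: L0_def Vec.component_zero comp_minus Vec.component_add component_smult smI)
  moreover have "\<one>\<^bsub>A\<^esub> \<notin> L0"
    using one Vec.component_homogeneous[OF one_comp, of 0] by (simp add: L0_def)
  ultimately obtain L where L: "submodule L K A" "L0 \<subseteq> L" "\<one>\<^bsub>A\<^esub> \<notin> L"
    and max: "\<And>L'. \<lbrakk>submodule L' K A; L \<subseteq> L'; \<one>\<^bsub>A\<^esub> \<notin> L'\<rbrakk> \<Longrightarrow> L' = L"
    using ex_maximal_subspace[of L0 "\<one>\<^bsub>A\<^esub>"] by auto
  note LE = Vec.submoduleE[OF L(1)]
  have L_carrier: "l \<in> carrier A" if "l \<in> L" for l using that LE(1) by blast
  have L_zero: "\<zero>\<^bsub>A\<^esub> \<in> L"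
    using subgroup.one_closed[OF submodule.axioms(1)[OF L(1)]] by simp
  have ex: "\<exists>c\<in>carrier K. a \<ominus>\<^bsub>A\<^esub> c \<odot>\<^bsub>A\<^esub> \<one>\<^bsub>A\<^esub> \<in> L" if a: "a \<in> carrier A" for a
  proof (cases "a \<in> L")
    case True
    then have "a \<ominus>\<^bsub>A\<^esub> \<zero>\<^bsub>K\<^esub> \<odot>\<^bsub>A\<^esub> \<one>\<^bsub>A\<^esub> \<in> L" using a by (simp add: a_minus_def)
    then show ?thesis by blast
  next
    case False
    \<comment> \<open>The span of \<open>a\<close> and \<open>L\<close> is larger than
      \<open>L\<close>, so by maximality it contains the unit; solving that relation for
      \<open>a\<close> yields its coordinate.\<close>
    define L' where "L' = {c \<odot>\<^bsub>A\<^esub> a \<oplus>\<^bsub>A\<^esub> l | c l. c \<in> carrier K \<and> l \<in> L}"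
    have L'I: "c \<odot>\<^bsub>A\<^esub> a \<oplus>\<^bsub>A\<^esub> l \<in> L'" if "c \<in> carrier K" "l \<in> L" for c l
      using that by (auto simp: L'_def)
    have "submodule L' K A"
    proof (rule Vec.submoduleI)
      show "L' \<subseteq> carrier A" using a L_carrier by (auto simp: L'_def)
      show "\<zero>\<^bsub>A\<^esub> \<in> L'" using L'I[OF _ L_zero, of "\<zero>\<^bsub>K\<^esub>"] a by simp
    next
      fix x assume "x \<in> L'"
      then obtain c l where x: "c \<in> carrier K" "l \<in> L" "x = c \<odot>\<^bsub>A\<^esub> a \<oplus>\<^bsub>A\<^esub> l"
        by (auto simp: L'_def)
      then have "\<ominus>\<^bsub>A\<^esub> x = (\<ominus>\<^bsub>K\<^esub> c) \<odot>\<^bsub>A\<^esub> a \<oplus>\<^bsub>A\<^esub> \<ominus>\<^bsub>A\<^esub> l"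
        using a L_carrier by (simp add: Vec.minus_add Vec.smult_l_minus Vec.a_comm)
      then show "\<ominus>\<^bsub>A\<^esub> x \<in> L'" using L'I x LE(3) by simp
      fix e assume e: "e \<in> carrier K"
      then have "e \<odot>\<^bsub>A\<^esub> x = (e \<otimes>\<^bsub>K\<^esub> c) \<odot>\<^bsub>A\<^esub> a \<oplus>\<^bsub>A\<^esub> e \<odot>\<^bsub>A\<^esub> l"
        using x a L_carrier by (simp add: Vec.smult_r_distr Vec.smult_assoc1)
      then show "e \<odot>\<^bsub>A\<^esub> x \<in> L'" using L'I x e LE(4) by simp
    next
      fix x y assume "x \<in> L'" "y \<in> L'"
      then obtain c l e m where x: "c \<in> carrier K" "l \<in> L" "x = c \<odot>\<^bsub>A\<^esub> a \<oplus>\<^bsub>A\<^esub> l"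
        and y: "e \<in> carrier K" "m \<in> L" "y = e \<odot>\<^bsub>A\<^esub> a \<oplus>\<^bsub>A\<^esub> m"
        by (auto simp: L'_def)
      then have "x \<oplus>\<^bsub>A\<^esub> y = (c \<oplus>\<^bsub>K\<^esub> e) \<odot>\<^bsub>A\<^esub> a \<oplus>\<^bsub>A\<^esub> (l \<oplus>\<^bsub>A\<^esub> m)"
        using a L_carrier by (simp add: Vec.smult_l_distr Vec.a_ac)
      then show "x \<oplus>\<^bsub>A\<^esub> y \<in> L'" using L'I x y LE(5) by simp
    qed
    moreover have "L \<subseteq> L'"
    proof
      fix l assume "l \<in> L"
      then show "l \<in> L'" using L'I[of "\<zero>\<^bsub>K\<^esub>" l] a L_carrier by simp
    qed
    moreover have "a \<in> L'" using L'I[OF _ L_zero, of "\<one>\<^bsub>K\<^esub>"] a by simp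
    ultimately have "\<one>\<^bsub>A\<^esub> \<in> L'" using max False by blast
    then obtain c l where c: "c \<in> carrier K" "l \<in> L" "\<one>\<^bsub>A\<^esub> = c \<odot>\<^bsub>A\<^esub> a \<oplus>\<^bsub>A\<^esub> l"
      by (auto simp: L'_def)
    \<comment> \<open>Otherwise the unit would equal \<open>l\<close> and lie in \<open>L\<close>.
      Hence the relation can be divided by \<open>c\<close>.\<close>
    have "c \<noteq> \<zero>\<^bsub>K\<^esub>"
    proof
      assume "c = \<zero>\<^bsub>K\<^esub>"
      then show False using c L(3) a L_carrier by simp
    qed
    then have inv: "inv\<^bsub>K\<^esub> c \<in> carrier K" "inv\<^bsub>K\<^esub> c \<otimes>\<^bsub>K\<^esub> c = \<one>\<^bsub>K\<^esub>"
      using c(1) field_Units by auto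
    have "inv\<^bsub>K\<^esub> c \<odot>\<^bsub>A\<^esub> \<one>\<^bsub>A\<^esub> = a \<oplus>\<^bsub>A\<^esub> inv\<^bsub>K\<^esub> c \<odot>\<^bsub>A\<^esub> l"
      unfolding c(3) using inv c(1,2) a L_carrier
      by (simp add: Vec.smult_r_distr flip: Vec.smult_assoc1)
    then have "a \<ominus>\<^bsub>A\<^esub> inv\<^bsub>K\<^esub> c \<odot>\<^bsub>A\<^esub> \<one>\<^bsub>A\<^esub> = \<ominus>\<^bsub>A\<^esub> (inv\<^bsub>K\<^esub> c \<odot>\<^bsub>A\<^esub> l)"
      using inv(1) c(2) a L_carrier by (simp add: a_minus_def Vec.minus_add Vec.r_neg2)
    then have "a \<ominus>\<^bsub>A\<^esub> inv\<^bsub>K\<^esub> c \<odot>\<^bsub>A\<^esub> \<one>\<^bsub>A\<^esub> \<in> L"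
      using LE(3)[OF LE(4)[OF inv(1) c(2)]] by simp
    then show ?thesis using inv(1) by blast
  qed
  \<comment> \<open>Two coordinates of the same element would put a nonzero multiple of the unit
    into \<open>L\<close>, and then the unit itself.\<close>
  have unique: "c = e"
    if "c \<in> carrier K" "e \<in> carrier K" "a \<in> carrier A"
      "a \<ominus>\<^bsub>A\<^esub> c \<odot>\<^bsub>A\<^esub> \<one>\<^bsub>A\<^esub> \<in> L" "a \<ominus>\<^bsub>A\<^esub> e \<odot>\<^bsub>A\<^esub> \<one>\<^bsub>A\<^esub> \<in> L" for c e a
  proof (rule ccontr)
    assume "c \<noteq> e"
    let ?u = "e \<ominus>\<^bsub>K\<^esub> c"
    have u: "?u \<in> carrier K" "?u \<noteq> \<zero>\<^bsub>K\<^esub>"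
      using that(1,2) \<open>c \<noteq> e\<close> minus_equality[of e "\<ominus>\<^bsub>K\<^esub> c"] by (auto simp: a_minus_def)
    have "?u \<odot>\<^bsub>A\<^esub> \<one>\<^bsub>A\<^esub> = (a \<ominus>\<^bsub>A\<^esub> c \<odot>\<^bsub>A\<^esub> \<one>\<^bsub>A\<^esub>) \<oplus>\<^bsub>A\<^esub> \<ominus>\<^bsub>A\<^esub> (a \<ominus>\<^bsub>A\<^esub> e \<odot>\<^bsub>A\<^esub> \<one>\<^bsub>A\<^esub>)"
      using that(1-3)
      by (simp add: a_minus_def Vec.smult_l_distr Vec.smult_l_minus Vec.minus_add Vec.a_ac
          Vec.r_neg2 Vec.add_conjugate Vec.add_conjugate')
    then have uL: "?u \<odot>\<^bsub>A\<^esub> \<one>\<^bsub>A\<^esub> \<in> L" using that(4,5) LE(3,5) by simp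
    have "inv\<^bsub>K\<^esub> ?u \<in> carrier K" "inv\<^bsub>K\<^esub> ?u \<otimes>\<^bsub>K\<^esub> ?u = \<one>\<^bsub>K\<^esub>"
      using u field_Units by auto
    moreover from this have "\<one>\<^bsub>A\<^esub> = inv\<^bsub>K\<^esub> ?u \<odot>\<^bsub>A\<^esub> (?u \<odot>\<^bsub>A\<^esub> \<one>\<^bsub>A\<^esub>)"
      using u(1) by (simp flip: Vec.smult_assoc1)
    ultimately show False using L(3) LE(4) uL by metis
  qed
  define \<phi> where "\<phi> a =
    (if a \<in> carrier A then SOME c. c \<in> carrier K \<and> a \<ominus>\<^bsub>A\<^esub> c \<odot>\<^bsub>A\<^esub> \<one>\<^bsub>A\<^esub> \<in> L else \<zero>\<^bsub>K\<^esub>)" for a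
  have \<phi>: "\<phi> a \<in> carrier K" "a \<ominus>\<^bsub>A\<^esub> \<phi> a \<odot>\<^bsub>A\<^esub> \<one>\<^bsub>A\<^esub> \<in> L" if "a \<in> carrier A" for a
    using someI_ex[OF ex[OF that, unfolded Bex_def]] that by (auto simp: \<phi>_def)
  have \<phi>I: "\<phi> a = c" if "a \<in> carrier A" "c \<in> carrier K" "a \<ominus>\<^bsub>A\<^esub> c \<odot>\<^bsub>A\<^esub> \<one>\<^bsub>A\<^esub> \<in> L" for a c
    using unique[OF \<phi>(1) that(2) that(1) \<phi>(2) that(3)] that(1) by simp
  have \<phi>L: "\<phi> a = \<zero>\<^bsub>K\<^esub>" if "a \<in> L" for a
    using that L_carrier by (intro \<phi>I) (auto simp: a_minus_def)
  have L0L: "a \<in> L" if "a \<in> carrier A" "component A 0 a \<in> I" for a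
    using that L(2) by (auto simp: L0_def)
  have "\<phi> (a \<oplus>\<^bsub>A\<^esub> b) = \<phi> a \<oplus>\<^bsub>K\<^esub> \<phi> b" if "a \<in> carrier A" "b \<in> carrier A" for a b
  proof (rule \<phi>I)
    have "a \<oplus>\<^bsub>A\<^esub> b \<ominus>\<^bsub>A\<^esub> (\<phi> a \<oplus>\<^bsub>K\<^esub> \<phi> b) \<odot>\<^bsub>A\<^esub> \<one>\<^bsub>A\<^esub> =
        (a \<ominus>\<^bsub>A\<^esub> \<phi> a \<odot>\<^bsub>A\<^esub> \<one>\<^bsub>A\<^esub>) \<oplus>\<^bsub>A\<^esub> (b \<ominus>\<^bsub>A\<^esub> \<phi> b \<odot>\<^bsub>A\<^esub> \<one>\<^bsub>A\<^esub>)"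
      using that \<phi>(1) by (simp add: a_minus_def Vec.smult_l_distr Vec.minus_add Vec.a_ac)
    then show "a \<oplus>\<^bsub>A\<^esub> b \<ominus>\<^bsub>A\<^esub> (\<phi> a \<oplus>\<^bsub>K\<^esub> \<phi> b) \<odot>\<^bsub>A\<^esub> \<one>\<^bsub>A\<^esub> \<in> L"
      using \<phi>(2) that LE(5) by simp
  qed (use that \<phi>(1) in auto)
  moreover have "\<phi> (c \<odot>\<^bsub>A\<^esub> a) = c \<otimes>\<^bsub>K\<^esub> \<phi> a" if "c \<in> carrier K" "a \<in> carrier A" for c a
  proof (rule \<phi>I)
    have "c \<odot>\<^bsub>A\<^esub> a \<ominus>\<^bsub>A\<^esub> (c \<otimes>\<^bsub>K\<^esub> \<phi> a) \<odot>\<^bsub>A\<^esub> \<one>\<^bsub>A\<^esub> = c \<odot>\<^bsub>A\<^esub> (a \<ominus>\<^bsub>A\<^esub> \<phi> a \<odot>\<^bsub>A\<^esub> \<one>\<^bsub>A\<^esub>)"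
      using that \<phi>(1) by (simp add: a_minus_def Vec.smult_r_distr Vec.smult_r_minus Vec.smult_assoc1)
    then show "c \<odot>\<^bsub>A\<^esub> a \<ominus>\<^bsub>A\<^esub> (c \<otimes>\<^bsub>K\<^esub> \<phi> a) \<odot>\<^bsub>A\<^esub> \<one>\<^bsub>A\<^esub> \<in> L"
      using \<phi>(2) that LE(4) by simp
  qed (use that \<phi>(1) in auto)
  moreover have "\<phi> a = \<zero>\<^bsub>K\<^esub>" if "a \<in> I" for a
    using that IC by (intro \<phi>L L0L) auto
  \<comment> \<open>A homogeneous element of another degree has zero as its component of degree 0,
    so it lies in \<open>L0\<close>.\<close>
  moreover have "{i. \<exists>a\<in>comp A i. \<phi> a \<noteq> \<zero>\<^bsub>K\<^esub>} \<subseteq> {0}"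
  proof
    fix i assume "i \<in> {i. \<exists>a\<in>comp A i. \<phi> a \<noteq> \<zero>\<^bsub>K\<^esub>}"
    then obtain a where a: "a \<in> comp A i" "\<phi> a \<noteq> \<zero>\<^bsub>K\<^esub>" by blast
    then have "a \<notin> L" using \<phi>L by blast
    then show "i \<in> {0}"
      using L0L[OF Vec.comp_carrier[OF a(1)]] Vec.component_homogeneous[OF a(1), of 0]
      by (auto split: if_splits)
  qed
  moreover have "\<phi> a \<in> carrier K" "a \<notin> carrier A \<Longrightarrow> \<phi> a = \<zero>\<^bsub>K\<^esub>" for a
    using \<phi>(1) by (cases "a \<in> carrier A"; simp add: \<phi>_def)+
  ultimately have "\<phi> \<in> graded_dual K A I"
    by (auto simp: graded_dual_def dest: finite_subset)
  moreover have "\<phi> \<one>\<^bsub>A\<^esub> = \<one>\<^bsub>K\<^esub>"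
    using L_zero by (intro \<phi>I) (auto simp: a_minus_def Vec.r_neg)
  ultimately show ?thesis by blast
qed

text \<open>Lets a submodule take part in the intersection that defines a generated module.
  Projection to degree \<open>i\<close> in the argument is the component of degree
  \<open>- i\<close> of the functional, hence the change of sign.\<close>

lemma dual_closed_submodule:
  assumes N: "dual_closed K A P N" and L: "dg_poisson_submodule L A (dual_module K A N)"
  shows "dual_closed K A P L"
proof -
  interpret D: dg_poisson_module K A "dual_module K A N" by (rule dual_dg_poisson_module[OF N])
  note L = D.submodule_facts[OF L] D.submodule_closed[OF L]
  have "pullback K A (component A i) f \<in> L" if "f \<in> L" for f i
    using L(5)[OF that, of "- i"] L(1) that dual_graded(2)[OF N, of f "- i"] by auto
  then show ?thesis
    using L N by (auto simp: dual_closed_def)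
qed

text \<open>A nonempty family is what keeps the intersection inside the graded dual.\<close>

lemma dual_closed_Inter:
  assumes "C \<noteq> {}" "\<And>N. N \<in> C \<Longrightarrow> dual_closed K A P N"
  shows "dual_closed K A P (\<Inter>C)"
proof -
  have "\<Inter>C \<subseteq> graded_dual K A P"
    using assms dual_closedD(1) by blast
  then show ?thesis
    using dual_closedD(2-)[OF assms(2)] by (simp add: dual_closed_def)
qed

theorem dg_symplectic_ideal_annihilator:
  assumes "dg_symplectic_ideal P A"
  shows "\<exists>X :: ('a, ('a \<Rightarrow> 'k) set) dg_poisson_mod.
    simple_dg_poisson_module K A X \<and> P = module_annihilator A X"
proof -
  obtain I where I: "maximal_dg_ideal I A" and P: "dg_poisson_ideal P A" "P \<subseteq> I"
    and P_max: "\<And>J. \<lbrakk>dg_poisson_ideal J A; J \<subseteq> I\<rbrakk> \<Longrightarrow> J \<subseteq> P"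
    using assms by (auto simp: dg_symplectic_ideal_def)
  interpret I: ideal I A using I by (simp add: maximal_dg_ideal_def dg_ideal_def)
  interpret P: ideal P A using P by (simp add: dg_poisson_ideal_def dg_ideal_def)
  obtain \<phi> where \<phi>: "\<phi> \<in> graded_dual K A I" "\<phi> \<one>\<^bsub>A\<^esub> = \<one>\<^bsub>K\<^esub>"
    using ex_functional[of I] I by (auto simp: maximal_dg_ideal_def)
  define N where "N = \<Inter>{N. dual_closed K A P N \<and> \<phi> \<in> N}"
  \<comment> \<open>Vanishing on \<open>I\<close> implies vanishing on the smaller \<open>P\<close>.
    Hence the whole graded dual modulo \<open>P\<close> belongs to the family, which is therefore
    nonempty.\<close>
  have "\<phi> \<in> graded_dual K A P"
    using \<phi>(1) P(2) by (auto simp: graded_dual_def)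
  then have "graded_dual K A P \<in> {N. dual_closed K A P N \<and> \<phi> \<in> N}"
    using graded_dual_closed[OF P(1)] by blast
  then have N: "dual_closed K A P N"
    unfolding N_def by (intro dual_closed_Inter) auto
  have \<phi>N: "\<phi> \<in> N" by (simp add: N_def)
  let ?D = "dual_module K A N"
  interpret D: dg_poisson_module K A ?D by (rule dual_dg_poisson_module[OF N])
  have "\<phi> \<noteq> \<zero>\<^bsub>?D\<^esub>" using \<phi>(2) one_not_zero by (auto simp del: one_not_zero)
  \<comment> \<open>A submodule containing \<open>\<phi>\<close> is one of the sets intersected in
    \<open>N\<close>, so it contains \<open>N\<close>: this is cyclicity.\<close>
  moreover have "L = carrier ?D" if "dg_poisson_submodule L A ?D" "\<phi> \<in> L" for L
    using dual_closed_submodule[OF N that(1)] that(2) D.submodule_facts(1)[OF that(1)]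
    by (auto simp: N_def)
  ultimately obtain L where L: "dg_poisson_submodule L A ?D" "\<phi> \<notin> L"
    and simple: "simple_dg_poisson_module K A (quot_dg_poisson_mod ?D L)"
    using D.ex_simple_quotient[of \<phi>] \<phi>N by auto
  let ?X = "quot_dg_poisson_mod ?D L"
  interpret X: dg_poisson_module K A ?X by (rule D.dg_poisson_module_quotient[OF L(1)])
  have coset_zero: "L +>\<^bsub>?D\<^esub> f = \<zero>\<^bsub>?X\<^esub> \<longleftrightarrow> f \<in> L" if "f \<in> N" for f
    using D.quot_mod_eq_zero[OF L(1)] that by (simp add: D.quot_mod_zero[OF L(1)])
  have act_zero: "a \<odot>\<^bsub>?X\<^esub> (L +>\<^bsub>?D\<^esub> f) = \<zero>\<^bsub>?X\<^esub>"
    if "a \<in> carrier A" "f \<in> N" "\<And>b. b \<in> carrier A \<Longrightarrow> f (b \<otimes>\<^bsub>A\<^esub> a) = \<zero>\<^bsub>K\<^esub>" for a f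
  proof -
    have "a \<odot>\<^bsub>?D\<^esub> f = \<zero>\<^bsub>?D\<^esub>" using that(3) by (auto simp: pullback_def)
    then have "a \<odot>\<^bsub>?X\<^esub> (L +>\<^bsub>?D\<^esub> f) = L +>\<^bsub>?D\<^esub> \<zero>\<^bsub>?D\<^esub>"
      using D.quot_mod_smult[OF L(1) that(1), of f] that(2) by simp
    then show ?thesis
      using coset_zero[of "\<zero>\<^bsub>?D\<^esub>"] D.submodule_closed(1)[OF L(1)] dual_closedD(2)[OF N] by simp
  qed
  have "module_annihilator A ?X \<subseteq> I"
  proof (rule X.annihilator_subset_maximal_dg_ideal[OF I])
    show "L +>\<^bsub>?D\<^esub> \<phi> \<in> carrier ?X" using \<phi>N by (simp add: D.quot_mod_carrier[OF L(1)])
    show "L +>\<^bsub>?D\<^esub> \<phi> \<noteq> \<zero>\<^bsub>?X\<^esub>" using coset_zero[OF \<phi>N] L(2) by simp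
    fix a assume "a \<in> I"
    \<comment> \<open>The value at \<open>b\<close> is \<phi>(b a), and b a lies in the ideal
      \<open>I\<close>.\<close>
    then show "a \<odot>\<^bsub>?X\<^esub> (L +>\<^bsub>?D\<^esub> \<phi>) = \<zero>\<^bsub>?X\<^esub>"
      using \<phi>(1) \<phi>N I.I_l_closed by (intro act_zero) (auto simp: graded_dual_def)
  qed
  then have "module_annihilator A ?X \<subseteq> P"
    by (rule P_max[OF X.annihilator_dg_poisson_ideal])
  moreover have "P \<subseteq> module_annihilator A ?X"
  proof
    fix a assume "a \<in> P"
    \<comment> \<open>All of \<open>N\<close>, and not only \<open>\<phi>\<close>, vanishes on
      \<open>P\<close>, since closed sets lie in the graded dual modulo \<open>P\<close>.\<close>
    moreover have "f (b \<otimes>\<^bsub>A\<^esub> a) = \<zero>\<^bsub>K\<^esub>" if "f \<in> N" "b \<in> carrier A" for f b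
      using dualD(5)[OF N that(1)] P.I_l_closed[OF \<open>a \<in> P\<close> that(2)] .
    ultimately show "a \<in> module_annihilator A ?X"
      using act_zero by (auto simp: module_annihilator_def D.quot_mod_carrier[OF L(1)])
  qed
  ultimately show ?thesis using simple by blast
qed

end

theorem theorem4p10:
  fixes K :: "('k, 'z) ring_scheme"
    and V :: "('k, 'v) graded"
    and n :: nat
    and x :: "nat \<Rightarrow> 'v"
    and deg :: "nat \<Rightarrow> int"
    and d :: "('v list \<Rightarrow> 'k) set set \<Rightarrow> ('v list \<Rightarrow> 'k) set set"
    and br :: "('v list \<Rightarrow> 'k) set set \<Rightarrow> ('v list \<Rightarrow> 'k) set set \<Rightarrow> ('v list \<Rightarrow> 'k) set set"
    and R :: "('k, ('v list \<Rightarrow> 'k) set set) dg_poisson"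
    and I :: "('v list \<Rightarrow> 'k) set set set"
    and A :: "('k, ('v list \<Rightarrow> 'k) set set set) dg_poisson"
    and P :: "('v list \<Rightarrow> 'k) set set set set"
  assumes "field K"
    and "graded_vector_space K V"
    and "homogeneous_basis K V n x deg"
    and "R = add_dg_poisson (graded_symmetric_algebra K V n x deg) d br"
    and "dg_poisson_algebra K R"
    and "dg_poisson_ideal I R"
    and "A = quot_dg_poisson R I"
    and "dg_symplectic_ideal P A"
  shows "\<exists>X :: ('k, ('v list \<Rightarrow> 'k) set set set) concrete_dg_poisson_mod.
           simple_dg_poisson_module K A X \<and> P = module_annihilator A X"
proof -
  have "dg_poisson_algebra K A"
    unfolding assms(7) by (rule dg_poisson_algebra_quotient[OF assms(5,6)])
  \<comment> \<open>The module found consists of cosets in a space of functionals, so its elements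
    are sets of functions from \<open>A\<close> to \<open>K\<close>, as the concrete type of the
    claim prescribes.\<close>
  then show ?thesis
    by (rule dg_poisson_algebra.dg_symplectic_ideal_annihilator[OF _ assms(8)])
qed

end
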